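(* Let $\mathfrak g$ be of type $D_n$ and let $B_\epsilon$ be a tensor word in the fundamental crystals whose labels are arranged as follows. Let $a,b$ be the number of times $n-1$ and $n$ occur in $\epsilon$, respectively. If $b\ge a$, write $b-a=2q+r$ with $r\in\{0,1\}$ and $$B_\epsilon=B_{\epsilon_1}\otimes\cdots\otimes B_{\epsilon_s}\otimes(B_{n-1}\otimes B_n)^{\otimes a}\otimes(B_n\otimes B_n)^{\otimes q}\otimes B_n^{\otimes r};$$ if $a>b$, write $a-b=2q+r$ with $r\in\{0,1\}$ and $$B_\epsilon=B_{\epsilon_1}\otimes\cdots\otimes B_{\epsilon_s}\otimes(B_{n-1}\otimes B_n)^{\otimes b}\otimes(B_{n-1}\otimes B_{n-1})^{\otimes q}\otimes B_{n-1}^{\otimes r};$$ in both cases $\epsilon_1\le\cdots\le\epsilon_s\le n-2$. Regard $\epsilon$ as a word $\epsilon_1\cdots\epsilon_s\,x^ay^qn^r$, respectively $\epsilon_1\cdots\epsilon_s\,x^bz^q(n-1)^r$, in the letters $1,\dots,n,x,y,z$, where $x,y,z$ stand for $B_{n-1}\otimes B_n$, $B_n\otimes B_n$, $B_{n-1}\otimes B_{n-1}$, respectively. Let $\sigma_i$ be the identity-padded Jones--Wenzl projector applied to the tensor product corresponding to the $i$-th two-letter adjacent subword $uv$ of this word, where $u,v\in\{1,\dots,n,x,y,z\}$ (so $\sigma_i$ involves two, three or four adjacent tensor factors). Then $$j_\epsilon=\prod_i\sigma_i.$$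
   Context: $\mathfrak g$ is the simple complex Lie algebra of type $D_n$ with fundamental weights $\omega_1,\dots,\omega_n$ in the usual labeling (so $\omega_{n-1},\omega_n$ are the half-spin weights), and $B_i=B(\omega_i)$ is the crystal of the $i$th fundamental representation, with Kashiwara operators $e_i,f_i:B\to B\sqcup\{0\}$, $\varepsilon_i(b)=\max\{m\ge 0:e_i^mb\ne0\}$, $\varphi_i(b)=\max\{m\ge 0:f_i^mb\ne0\}$. The tensor product $B\otimes C$ of crystals is the set $B\times C$ with weights added and with the convention $e_i(b\otimes c)=e_ib\otimes c$ if $\varphi_i(b)\ge\varepsilon_i(c)$ and $b\otimes e_ic$ otherwise; $f_i(b\otimes c)=f_ib\otimes c$ if $\varphi_i(b)>\varepsilon_i(c)$ and $b\otimes f_ic$ otherwise. A (strict) crystal morphism is a map $B\sqcup\{0\}\to C\sqcup\{0\}$ with $0\mapsto0$, preserving weights of elements not sent to $0$, and commuting with all $e_i,f_i$; morphisms in the category of $\mathfrak g$-crystals are linear combinations (over a field $\Bbbk$) of these. For a word $\epsilon=(\epsilon_1,\dots,\epsilon_m)$ in $\{1,\dots,n\}$, the tensor word is $B_\epsilon=B_{\epsilon_1}\otimes\cdots\otimes B_{\epsilon_m}$. The top component (top summand) of $B_\epsilon$ is its unique connected component of highest weight $\sum_k\omega_{\epsilon_k}$. The Jones--Wenzl projector $j_\epsilon\in\mathrm{End}(B_\epsilon)$ is the identity on the top component and zero on all other components. "Identity-padded" means tensored on the left and right with identity morphisms of the remaining tensor factors. Products denote composition.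
   Formalization: The one-letter words x, y, z (that is, ε = (n-1,n), (n,n), (n-1,n-1)) are excluded: they have no two-letter subword, so the product is the identity, while the tensor product is disconnected and j_ε is not the identity. *)

theory Defs
  imports Main
begin

section \<open>Crystals\<close>

text \<open>A weight \<open>\<lambda>\<close> is given by its coordinates \<open>\<lambda> i = \<langle>\<lambda>, \<alpha>\<^sub>i\<^sup>\<vee>\<rangle>\<close>, \<open>1 \<le> i \<le> n\<close>, in the
  basis of fundamental weights; all other coordinates are \<open>0\<close>.\<close>

type_synonym weight = "nat \<Rightarrow> int"

text \<open>The extra element \<open>0\<close> adjoined to a crystal is \<^const>\<open>None\<close>, so that maps
  \<open>B \<squnion> {0} \<rightarrow> C \<squnion> {0}\<close> are functions between option types.\<close>

record 'b crystal =
  elems :: "'b set"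
  wt :: "'b \<Rightarrow> weight"
  e_op :: "nat \<Rightarrow> 'b \<Rightarrow> 'b option"
  f_op :: "nat \<Rightarrow> 'b \<Rightarrow> 'b option"

definition eps :: "'b crystal \<Rightarrow> nat \<Rightarrow> 'b \<Rightarrow> nat" where
  "eps B i b = Max {m. ((\<lambda>x. Option.bind x (e_op B i)) ^^ m) (Some b) \<noteq> None}"

definition phi :: "'b crystal \<Rightarrow> nat \<Rightarrow> 'b \<Rightarrow> nat" where
  "phi B i b = Max {m. ((\<lambda>x. Option.bind x (f_op B i)) ^^ m) (Some b) \<noteq> None}"

definition tensor :: "'b crystal \<Rightarrow> 'c crystal \<Rightarrow> ('b \<times> 'c) crystal" where
  "tensor B C =
    \<lparr> elems = elems B \<times> elems C,
      wt = (\<lambda>(b, c) i. wt B b i + wt C c i),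
      e_op = (\<lambda>i (b, c). if phi B i b \<ge> eps C i c
                          then map_option (\<lambda>b'. (b', c)) (e_op B i b)
                          else map_option (\<lambda>c'. (b, c')) (e_op C i c)),
      f_op = (\<lambda>i (b, c). if phi B i b > eps C i c
                          then map_option (\<lambda>b'. (b', c)) (f_op B i b)
                          else map_option (\<lambda>c'. (b, c')) (f_op C i c)) \<rparr>"

text \<open>Transport of a crystal along a bijection \<open>g\<close> with inverse \<open>h\<close>.\<close>

definition transport :: "('b \<Rightarrow> 'c) \<Rightarrow> ('c \<Rightarrow> 'b) \<Rightarrow> 'b crystal \<Rightarrow> 'c crystal" where
  "transport g h B =
    \<lparr> elems = g ` elems B,
      wt = (\<lambda>c. wt B (h c)),
      e_op = (\<lambda>i c. map_option g (e_op B i (h c))),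
      f_op = (\<lambda>i c. map_option g (f_op B i (h c))) \<rparr>"

text \<open>Iterated tensor products, with \<open>b\<^sub>1 \<otimes> \<dots> \<otimes> b\<^sub>m\<close> written as the list \<open>[b\<^sub>1, \<dots>, b\<^sub>m]\<close>.
  The tensor product is associative, so the bracketing does not matter.\<close>

fun tensor_list :: "'b crystal list \<Rightarrow> 'b list crystal" where
  "tensor_list [] =
    \<lparr> elems = {[]}, wt = (\<lambda>_ _. 0), e_op = (\<lambda>_ _. None), f_op = (\<lambda>_ _. None) \<rparr>"
| "tensor_list (B # Bs) =
    transport (\<lambda>(b, bs). b # bs) (\<lambda>bs. (hd bs, tl bs)) (tensor B (tensor_list Bs))"

definition arrows :: "'b crystal \<Rightarrow> ('b \<times> 'b) set" where
  "arrows B = {(b, c). b \<in> elems B \<and> c \<in> elems B \<and>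
                 (\<exists>i. e_op B i b = Some c \<or> f_op B i b = Some c)}"

definition connected_in :: "'b crystal \<Rightarrow> 'b \<Rightarrow> 'b \<Rightarrow> bool" where
  "connected_in B b c \<longleftrightarrow> (b, c) \<in> (arrows B \<union> (arrows B)\<inverse>)\<^sup>*"

definition component :: "'b crystal \<Rightarrow> 'b \<Rightarrow> 'b crystal" where
  "component B u = B\<lparr>elems := {b. connected_in B u b}\<rparr>"

definition highest_weight_elem :: "'b crystal \<Rightarrow> weight \<Rightarrow> 'b \<Rightarrow> bool" where
  "highest_weight_elem B \<nu> u \<longleftrightarrow> u \<in> elems B \<and> wt B u = \<nu> \<and> (\<forall>i. e_op B i u = None)"

definition strict_morphism :: "'b crystal \<Rightarrow> 'c crystal \<Rightarrow> ('b option \<Rightarrow> 'c option) \<Rightarrow> bool" where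
  "strict_morphism B C h \<longleftrightarrow> h None = None \<and>
    (\<forall>b\<in>elems B.
      (\<forall>c. h (Some b) = Some c \<longrightarrow> c \<in> elems C \<and> wt C c = wt B b) \<and>
      (\<forall>i. h (e_op B i b) = Option.bind (h (Some b)) (e_op C i)) \<and>
      (\<forall>i. h (f_op B i b) = Option.bind (h (Some b)) (f_op C i)))"

text \<open>The identity on \<open>S\<close> and zero elsewhere. In particular all maps below vanish outside the
  underlying set of their domain, so equality of functions is equality of maps
  \<open>B \<squnion> {0} \<rightarrow> C \<squnion> {0}\<close>.\<close>

definition proj_on :: "'b set \<Rightarrow> 'b option \<Rightarrow> 'b option" where
  "proj_on S x = Option.bind x (\<lambda>b. if b \<in> S then Some b else None)"

definition id_crystal :: "'b crystal \<Rightarrow> 'b option \<Rightarrow> 'b option" where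
  "id_crystal B = proj_on (elems B)"

text \<open>The tensor product \<open>g \<otimes> h\<close> of maps between iterated tensor products,
  where the domain of \<open>g\<close> has \<open>k\<close> factors.\<close>

definition tensor_map ::
  "nat \<Rightarrow> ('b list option \<Rightarrow> 'b list option) \<Rightarrow> ('b list option \<Rightarrow> 'b list option)
    \<Rightarrow> 'b list option \<Rightarrow> 'b list option" where
  "tensor_map k g h x =
    Option.bind x (\<lambda>bs. Option.bind (g (Some (take k bs))) (\<lambda>cs.
      Option.bind (h (Some (drop k bs))) (\<lambda>ds. Some (cs @ ds))))"

section \<open>The fundamental crystals of type \<open>D\<^sub>n\<close>\<close>

text \<open>Dynkin diagram: the chain \<open>1 - 2 - \<dots> - (n-1)\<close> together with an edge \<open>(n-2) - n\<close>.\<close>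

definition adjacent_D :: "nat \<Rightarrow> nat \<Rightarrow> nat \<Rightarrow> bool" where
  "adjacent_D n i j \<longleftrightarrow>
    (j = i + 1 \<and> j \<le> n - 1) \<or> (i = j + 1 \<and> i \<le> n - 1) \<or>
    (i = n - 2 \<and> j = n) \<or> (i = n \<and> j = n - 2)"

definition cartan_D :: "nat \<Rightarrow> nat \<Rightarrow> nat \<Rightarrow> int" where
  "cartan_D n i j = (if i = j then 2 else if adjacent_D n i j then - 1 else 0)"

definition simple_root :: "nat \<Rightarrow> nat \<Rightarrow> weight" where
  "simple_root n j = (\<lambda>i. if i \<in> {1..n} then cartan_D n i j else 0)"

definition fund_weight :: "nat \<Rightarrow> weight" where
  "fund_weight k = (\<lambda>i. if i = k then 1 else 0)"

definition simple_refl :: "nat \<Rightarrow> nat \<Rightarrow> weight \<Rightarrow> weight" where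
  "simple_refl n i \<mu> = (\<lambda>j. \<mu> j - \<mu> i * simple_root n i j)"

inductive_set weyl_orbit :: "nat \<Rightarrow> weight \<Rightarrow> weight set" for n :: nat and \<nu> :: weight where
  base: "\<nu> \<in> weyl_orbit n \<nu>"
| refl: "\<mu> \<in> weyl_orbit n \<nu> \<Longrightarrow> i \<in> {1..n} \<Longrightarrow> simple_refl n i \<mu> \<in> weyl_orbit n \<nu>"

text \<open>For \<open>k \<in> {1, n-1, n}\<close> the representation with highest weight \<open>\<omega>\<^sub>k\<close> (vector and half-spin)
  is minuscule: its weights form one Weyl group orbit, have multiplicity one, and all
  their coordinates lie in \<open>{-1, 0, 1}\<close>. Its crystal is therefore that orbit, with \<open>e\<^sub>i\<close> and \<open>f\<^sub>i\<close>
  adding and subtracting \<open>\<alpha>\<^sub>i\<close> whenever the result is again a weight.\<close>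

definition minuscule_crystal :: "nat \<Rightarrow> nat \<Rightarrow> weight crystal" where
  "minuscule_crystal n k =
    \<lparr> elems = weyl_orbit n (fund_weight k),
      wt = (\<lambda>\<mu>. \<mu>),
      e_op = (\<lambda>i \<mu>. if i \<in> {1..n} \<and> \<mu> i = - 1
                     then Some (\<lambda>j. \<mu> j + simple_root n i j) else None),
      f_op = (\<lambda>i \<mu>. if i \<in> {1..n} \<and> \<mu> i = 1
                     then Some (\<lambda>j. \<mu> j - simple_root n i j) else None) \<rparr>"

text \<open>The weight usually written \<open>\<epsilon>\<^sub>j\<close>; it equals \<open>\<omega>\<^sub>j - \<omega>\<^sub>j\<^sub>-\<^sub>1\<close> for \<open>j \<le> n - 2\<close>, where \<open>\<omega>\<^sub>0 = 0\<close>.\<close>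

definition coord_weight :: "nat \<Rightarrow> weight" where
  "coord_weight j = (\<lambda>i. fund_weight j i - (if j = 1 then 0 else fund_weight (j - 1) i))"

text \<open>For \<open>k \<le> n - 2\<close>, \<open>\<epsilon>\<^sub>1 \<otimes> \<dots> \<otimes> \<epsilon>\<^sub>k\<close> is a highest weight element of weight \<open>\<omega>\<^sub>k\<close> in the
  \<open>k\<close>-th tensor power of the vector crystal, so its component is \<open>B(\<omega>\<^sub>k)\<close> (this is the
  Kashiwara--Nakashima realisation by columns). The half-spin crystals are viewed as
  crystals of one-element lists, so that all fundamental crystals have the same type.\<close>

definition fund_crystal :: "nat \<Rightarrow> nat \<Rightarrow> weight list crystal" where
  "fund_crystal n k =
    (if k \<le> n - 2
     then component (tensor_list (replicate k (minuscule_crystal n 1)))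
            (map coord_weight [1..<k + 1])
     else tensor_list [minuscule_crystal n k])"

section \<open>Tensor words and Jones--Wenzl projectors\<close>

definition tensor_word :: "nat \<Rightarrow> nat list \<Rightarrow> weight list list crystal" where
  "tensor_word n w = tensor_list (map (fund_crystal n) w)"

definition top_component :: "nat \<Rightarrow> nat list \<Rightarrow> weight list list set" where
  "top_component n w =
    {b. \<exists>u. highest_weight_elem (tensor_word n w) (\<lambda>i. \<Sum>k\<leftarrow>w. fund_weight k i) u \<and>
            connected_in (tensor_word n w) u b}"

definition jones_wenzl ::
  "nat \<Rightarrow> nat list \<Rightarrow> weight list list option \<Rightarrow> weight list list option" where
  "jones_wenzl n w = proj_on (top_component n w)"

definition padded_jones_wenzl ::
  "nat \<Rightarrow> nat list \<Rightarrow> nat list \<Rightarrow> nat list \<Rightarrow> weight list list option \<Rightarrow> weight list list option"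
  where
  "padded_jones_wenzl n l w r =
    tensor_map (length l) (id_crystal (tensor_word n l))
      (tensor_map (length w) (jones_wenzl n w) (id_crystal (tensor_word n r)))"

datatype letter = Fund nat | X | Y | Z

fun letter_labels :: "nat \<Rightarrow> letter \<Rightarrow> nat list" where
  "letter_labels n (Fund k) = [k]"
| "letter_labels n X = [n - 1, n]"
| "letter_labels n Y = [n, n]"
| "letter_labels n Z = [n - 1, n - 1]"

definition word_labels :: "nat \<Rightarrow> letter list \<Rightarrow> nat list" where
  "word_labels n w = concat (map (letter_labels n) w)"

text \<open>The projector attached to the adjacent letters in positions \<open>i\<close> and \<open>i + 1\<close>,
  counted from \<open>0\<close>; a word of length \<open>m\<close> has them for \<open>i < m - 1\<close>.\<close>

definition sigma ::
  "nat \<Rightarrow> letter list \<Rightarrow> nat \<Rightarrow> weight list list option \<Rightarrow> weight list list option" where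
  "sigma n w i =
    padded_jones_wenzl n (word_labels n (take i w)) (word_labels n [w ! i, w ! (i + 1)])
      (word_labels n (drop (i + 2) w))"

text \<open>For a one-letter word there is no adjacent pair and the product is the identity; for the
  words \<open>x\<close>, \<open>y\<close>, \<open>z\<close> this is not the Jones--Wenzl projector, since the tensor product of two
  half-spin crystals is not connected.\<close>

definition sigma_prod ::
  "nat \<Rightarrow> letter list \<Rightarrow> weight list list option \<Rightarrow> weight list list option" where
  "sigma_prod n w =
    foldr (\<circ>) (map (sigma n w) [0..<length w - 1]) (id_crystal (tensor_word n (word_labels n w)))"

section \<open>Jones--Wenzl projectors are crystal endomorphisms\<close>

definition closed_crystal :: "'b crystal \<Rightarrow> bool" where
  "closed_crystal B \<longleftrightarrow>
    (\<forall>b\<in>elems B. \<forall>i c. e_op B i b = Some c \<or> f_op B i b = Some c \<longrightarrow> c \<in> elems B)"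

lemma closed_crystalD:
  assumes "closed_crystal B" "b \<in> elems B"
  shows "e_op B i b = Some c \<Longrightarrow> c \<in> elems B" "f_op B i b = Some c \<Longrightarrow> c \<in> elems B"
  using assms unfolding closed_crystal_def by blast+

lemma closed_minuscule: "closed_crystal (minuscule_crystal n k)"
proof -
  have "(\<lambda>j. \<mu> j + simple_root n i j) = simple_refl n i \<mu>" if "\<mu> i = - 1" for \<mu> i
    using that by (simp add: simple_refl_def)
  moreover have "(\<lambda>j. \<mu> j - simple_root n i j) = simple_refl n i \<mu>" if "\<mu> i = 1" for \<mu> i
    using that by (simp add: simple_refl_def)
  ultimately show ?thesis
    by (auto simp: closed_crystal_def minuscule_crystal_def split: if_splits
        intro: weyl_orbit.refl)
qed

lemma closed_tensor_list:
  "(\<And>B. B \<in> set Bs \<Longrightarrow> closed_crystal B) \<Longrightarrow> closed_crystal (tensor_list Bs)"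
proof (induction Bs)
  case Nil
  show ?case by (simp add: closed_crystal_def)
next
  case (Cons B Bs)
  have "closed_crystal B" "closed_crystal (tensor_list Bs)"
    using Cons by auto
  note closed = this[THEN closed_crystalD(1)] this[THEN closed_crystalD(2)]
  show ?case
    unfolding closed_crystal_def
    by (auto simp: transport_def tensor_def split: if_splits dest: closed)
qed

lemma connected_in_step:
  assumes "closed_crystal B" "b \<in> elems B" "e_op B i b = Some c \<or> f_op B i b = Some c"
  shows "connected_in B u b \<longleftrightarrow> connected_in B u c"
proof -
  have "(b, c) \<in> arrows B"
    using assms unfolding arrows_def closed_crystal_def by blast
  then show ?thesis
    unfolding connected_in_def by (meson UnCI converseI rtrancl.rtrancl_into_rtrancl)
qed

lemma connected_in_elems:
  assumes "connected_in B u b" "u \<in> elems B"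
  shows "b \<in> elems B"
  using assms(1)[unfolded connected_in_def] assms(2)
  by (induction rule: rtrancl_induct) (auto simp: arrows_def)

lemma coord_weight_in_orbit:
  assumes "1 \<le> j" "j \<le> n - 2"
  shows "coord_weight j \<in> weyl_orbit n (fund_weight 1)"
  using assms
proof (induction j rule: dec_induct)
  case base
  show ?case by (simp add: coord_weight_def weyl_orbit.base)
next
  case (step j)
  have "coord_weight (Suc j) = simple_refl n j (coord_weight j)"
    using step by (auto simp: fun_eq_iff simple_refl_def coord_weight_def fund_weight_def
        simple_root_def cartan_D_def adjacent_D_def)
  then show ?case
    using step by (auto intro: weyl_orbit.refl)
qed

lemma elems_tensor_list: "elems (tensor_list Bs) = {bs. list_all2 (\<lambda>b B. b \<in> elems B) bs Bs}"
  by (induction Bs) (auto simp: transport_def tensor_def list_all2_Cons2)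

lemma closed_component:
  assumes "closed_crystal B" "u \<in> elems B"
  shows "closed_crystal (component B u)"
  unfolding closed_crystal_def
proof (intro ballI allI impI)
  fix b i c
  assume "b \<in> elems (component B u)"
    and step: "e_op (component B u) i b = Some c \<or> f_op (component B u) i b = Some c"
  then have b: "connected_in B u b" by (simp add: component_def)
  have "e_op B i b = Some c \<or> f_op B i b = Some c"
    using step by (simp add: component_def)
  then have "connected_in B u c"
    using connected_in_step assms(1) connected_in_elems[OF b assms(2)] b by metis
  then show "c \<in> elems (component B u)" by (simp add: component_def)
qed

lemma closed_fund_crystal: "closed_crystal (fund_crystal n k)"
proof (cases "k \<le> n - 2")
  case True
  have "map coord_weight [1..<k + 1] \<in> elems (tensor_list (replicate k (minuscule_crystal n 1)))"
    using True coord_weight_in_orbit[of _ n]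
    by (simp add: elems_tensor_list list_all2_conv_all_nth minuscule_crystal_def del: upt_Suc)
  then show ?thesis
    using True by (auto simp: fund_crystal_def closed_minuscule
        intro!: closed_component closed_tensor_list)
next
  case False
  then show ?thesis
    unfolding fund_crystal_def by (simp del: tensor_list.simps)
      (rule closed_tensor_list, simp add: closed_minuscule)
qed

lemma strict_morphism_jones_wenzl:
  "strict_morphism (tensor_word n w) (tensor_word n w) (jones_wenzl n w)"
proof -
  have cl: "closed_crystal (tensor_word n w)"
    unfolding tensor_word_def by (rule closed_tensor_list) (auto simp: closed_fund_crystal)
  have "b \<in> top_component n w \<longleftrightarrow> c \<in> top_component n w"
    if "b \<in> elems (tensor_word n w)"
      "e_op (tensor_word n w) i b = Some c \<or> f_op (tensor_word n w) i b = Some c" for b c i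
    using connected_in_step[OF cl that] by (simp add: top_component_def)
  then show ?thesis
    unfolding strict_morphism_def jones_wenzl_def proj_on_def
    by (auto split: Option.bind_splits)
qed

end

theory Submission
  imports Defs
begin

text \<open>Every tensor word is a crystal of words in the minuscule weights of the vector and half-spin
  representations, on which \<open>e\<^sub>i\<close> and \<open>f\<^sub>i\<close> act through the first and last minimum of the path of \<open>i\<close>-th
  coordinates. Any two raising operators are locally confluent on such words, so by Newman's lemma
  every component has exactly one highest weight element.

  The elements all of whose adjacent pairs of letters lie in top components form a union of components
  containing the top one, so it suffices that a highest weight element of this kind is the obvious one.
  Inductively its first letters are highest weight elements. If \<open>u\<close> is the last of them and \<open>c\<close> the next
  factor, then \<open>u \<otimes> c\<close> lies in the component of \<open>u \<otimes> c\<^sub>0\<close>. Raising \<open>c\<close> along the colours killed by the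
  weight of \<open>u\<close> leads to \<open>c\<^sub>0\<close>, because each letter is minuscule and uniqueness of highest weight elements
  applies letter by letter. The chosen order of the letters ensures that \<open>c\<close> could only have been
  lowered along colours on which \<open>c\<^sub>0\<close> is trivial, whence \<open>c = c\<^sub>0\<close>.\<close>

section \<open>Minuscule weights\<close>

text \<open>Uniqueness of highest weight elements is not given with the definitions: the crystals
  are explicit combinatorial models without a representation behind them. Flattening a nested tensor
  product into a single word of weights removes the bracketing and the different kinds of factors,
  so that uniqueness has to be proved for words only. Minuscule letters make this feasible: every
  step of a path is -1, 0 or 1, so a raising operator adds one simple root to one letter, and
  confluence becomes a comparison of two minima that can interfere only at adjacent colours.

  A pair condition sees the weight of the preceding letter but not of everything before it. Raising
  inside the pair may therefore use every colour that the preceding letter kills, whereas highest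
  weight of the whole word controls the new factor only at colours absent from all earlier letters.
  Closing this gap is the purpose of the arrangement. The product of projectors is harmless, because
  projections onto subsets commute and compose to intersections.\<close>

definition mweights :: "nat \<Rightarrow> weight set" where
  "mweights n = (\<Union>k\<in>{1, n - 1, n}. weyl_orbit n (fund_weight k))"

lemma simple_root_self: "i \<in> {1..n} \<Longrightarrow> simple_root n i i = 2"
  by (simp add: simple_root_def cartan_D_def)

lemma simple_root_commute: "i \<in> {1..n} \<Longrightarrow> j \<in> {1..n} \<Longrightarrow> simple_root n i j = simple_root n j i"
  by (auto simp: simple_root_def cartan_D_def adjacent_D_def)

lemma simple_root_cases:
  "i \<in> {1..n} \<Longrightarrow> j \<noteq> i \<Longrightarrow> simple_root n i j = 0 \<or> simple_root n i j = -1 \<and> adjacent_D n j i"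
  by (auto simp: simple_root_def cartan_D_def)

text \<open>Half the sum and half the difference of two doubled coordinates are pairings with
  coroots, here confined to -1, 0 and 1. Doubling keeps the half-spin weights integral.\<close>

definition minuscule_pair :: "int \<Rightarrow> int \<Rightarrow> bool" where
  "minuscule_pair a b \<longleftrightarrow> a + b \<in> {-2, 0, 2} \<and> a - b \<in> {-2, 0, 2}"

lemma minuscule_pair_signs:
  "minuscule_pair (- a) b \<longleftrightarrow> minuscule_pair a b"
  "minuscule_pair a (- b) \<longleftrightarrow> minuscule_pair a b"
  by (auto simp: minuscule_pair_def)

text \<open>\<open>x\<close> lists twice the coordinates of \<open>\<mu>\<close> in the orthonormal basis \<open>\<epsilon>\<^sub>1, \<dots>, \<epsilon>\<^sub>n\<close>; the last
  clause bounds the pairings of \<open>\<mu>\<close> with all coroots.\<close>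

definition eps_coords :: "nat \<Rightarrow> weight \<Rightarrow> (nat \<Rightarrow> int) \<Rightarrow> bool" where
  "eps_coords n \<mu> x \<longleftrightarrow>
    (\<forall>i. 2 * \<mu> i = (if i \<in> {1..<n} then x i - x (Suc i) else if i = n then x (n - 1) + x n else 0)) \<and>
    (\<forall>p\<in>{1..n}. \<forall>q\<in>{1..n}. p \<noteq> q \<longrightarrow> minuscule_pair (x p) (x q))"

text \<open>The Weyl group acts on coordinates by permutations and even sign changes: the reflection
  at n exchanges and negates the last two, every other simple reflection exchanges two neighbours.
  Both respect the pair condition.\<close>

lemma eps_coords_refl:
  assumes n: "n \<ge> 3" and i: "i \<in> {1..n}" and x: "eps_coords n \<mu> x"
  shows "\<exists>y. eps_coords n (simple_refl n i \<mu>) y"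
proof -
  have r: "2 * \<mu> j = (if j \<in> {1..<n} then x j - x (Suc j) else if j = n then x (n - 1) + x n else 0)" for j
    using x by (simp add: eps_coords_def)
  have pq: "minuscule_pair (x p) (x q)" if "p \<in> {1..n}" "q \<in> {1..n}" "p \<noteq> q" for p q
    using x that by (simp add: eps_coords_def)
  show ?thesis
  proof (cases "i = n")
    case True
    let ?y = "x(n - 1 := - x n, n := - x (n - 1))"
    have s: "Suc j = n \<longleftrightarrow> j = n - 1" for j using n by auto
    have "2 * simple_refl n i \<mu> j =
      (if j \<in> {1..<n} then ?y j - ?y (Suc j) else if j = n then ?y (n - 1) + ?y n else 0)" for j
    proof -
      consider "j = n" | "j = n - 1" | "j = n - 2" | "1 \<le> j" "j < n - 2" | "j \<notin> {1..n}" using n by force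
      then show ?thesis
        using r[of j] r[of n] n True
        by cases (auto simp: simple_refl_def simple_root_def cartan_D_def adjacent_D_def s Suc_diff_Suc)
    qed
    moreover have "minuscule_pair (?y p) (?y q)"
      if pq': "p \<in> {1..n}" "q \<in> {1..n}" "p \<noteq> q" for p q
    proof -
      consider "p = n" "q = n - 1" | "p = n - 1" "q = n" | "p \<in> {n - 1, n}" "q \<notin> {n - 1, n}"
        | "p \<notin> {n - 1, n}" "q \<in> {n - 1, n}" | "p \<notin> {n - 1, n}" "q \<notin> {n - 1, n}" using pq' by auto
      then show ?thesis
        using pq[of "n - 1" n] pq[of n "n - 1"] pq[of "n - 1" q] pq[of n q] pq[of p "n - 1"] pq[of p n] pq[OF pq'] pq' n
        by cases (auto simp: minuscule_pair_signs)
    qed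
    ultimately show ?thesis unfolding eps_coords_def by blast
  next
    case False
    let ?y = "x(i := x (Suc i), Suc i := x i)"
    have i': "1 \<le> i" "i < n" using False i by auto
    have ri: "2 * \<mu> i = x i - x (Suc i)" using r[of i] i' by simp
    have rn: "2 * \<mu> n = x (n - 1) + x n" using r[of n] by simp
    have rj: "2 * \<mu> j = x j - x (Suc j)" if "1 \<le> j" "j < n" for j using r[of j] that by simp
    have refl: "2 * simple_refl n i \<mu> j = 2 * \<mu> j - 2 * \<mu> i * simple_root n i j" for j
      by (simp add: simple_refl_def algebra_simps)
    have "2 * simple_refl n i \<mu> j =
      (if j \<in> {1..<n} then ?y j - ?y (Suc j) else if j = n then ?y (n - 1) + ?y n else 0)" for j
    proof -
      \<comment> \<open>The n-th weight coordinate is built from \<open>x (n - 1)\<close> and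
        \<open>x n\<close>: it is symmetric under the reflection at n - 1 and changes under the one
        at n - 2, which reflects the fork of the diagram.\<close>
      consider "j = i" | "j = n" "i = n - 1" | "j = n" "i = n - 2" | "j = n" "i < n - 2"
        | "j < n" "j = Suc i" | "Suc j = i" "1 \<le> j"
        | "1 \<le> j" "j < n" "j \<noteq> i" "j \<noteq> Suc i" "Suc j \<noteq> i" | "j \<notin> {1..n}" using i' by force
      then show ?thesis
      proof cases
        case 1
        then have "simple_root n i j = 2" using i' by (simp add: simple_root_def cartan_D_def)
        then show ?thesis unfolding refl using ri 1 i' by simp
      next
        case 2
        then have "simple_root n i j = 0" "Suc i = n" using i' n
          by (auto simp: simple_root_def cartan_D_def adjacent_D_def)
        then show ?thesis unfolding refl using rn 2 by simp
      next
        case 3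
        then have "simple_root n i j = -1" "Suc i = n - 1" "n - 1 \<noteq> i" "n \<noteq> i" "n \<noteq> n - 1" using i' n
          by (auto simp: simple_root_def cartan_D_def adjacent_D_def)
        then show ?thesis unfolding refl using rn ri 3 by simp
      next
        case 4
        then have "simple_root n i j = 0" "Suc i \<noteq> n - 1" "n - 1 \<noteq> i" "n \<noteq> i" "n \<noteq> Suc i" using i' n
          by (auto simp: simple_root_def cartan_D_def adjacent_D_def)
        then show ?thesis unfolding refl using rn 4 by simp
      next
        case 5
        then have "simple_root n i j = -1" using i' n
          by (auto simp: simple_root_def cartan_D_def adjacent_D_def)
        then show ?thesis unfolding refl using rj[of j] ri 5 by simp
      next
        case 6
        then have "simple_root n i j = -1" "j < n" using i' n
          by (auto simp: simple_root_def cartan_D_def adjacent_D_def)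
        then show ?thesis unfolding refl using rj[of j] ri 6 by auto
      next
        case 7
        then have "simple_root n i j = 0" using i' n
          by (auto simp: simple_root_def cartan_D_def adjacent_D_def)
        then show ?thesis unfolding refl using rj[of j] 7 by simp
      next
        case 8
        then have "simple_root n i j = 0" "\<mu> j = 0" using r[of j] n by (auto simp: simple_root_def split: if_splits)
        then show ?thesis unfolding refl using 8 n by auto
      qed
    qed
    moreover have "minuscule_pair (?y p) (?y q)"
      if pq': "p \<in> {1..n}" "q \<in> {1..n}" "p \<noteq> q" for p q
    proof -
      let ?t = "\<lambda>p. if p = i then Suc i else if p = Suc i then i else p"
      have "minuscule_pair (x (?t p)) (x (?t q))" using pq[of "?t p" "?t q"] pq' i' by auto
      moreover have "?y p = x (?t p)" for p by simp
      ultimately show ?thesis by simp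
    qed
    ultimately show ?thesis unfolding eps_coords_def by blast
  qed
qed

lemma mweights_eps_coords:
  assumes n: "n \<ge> 3" and "\<mu> \<in> mweights n"
  shows "\<exists>x. eps_coords n \<mu> x"
proof -
  obtain k where k: "k \<in> {1, n - 1, n}" "\<mu> \<in> weyl_orbit n (fund_weight k)"
    using assms by (auto simp: mweights_def)
  from k(2) show ?thesis
  proof induction
    case base
    have "eps_coords n (fund_weight 1) (\<lambda>j. if j = 1 then 2 else 0)"
      "eps_coords n (fund_weight (n - 1)) (\<lambda>j. if j = n then -1 else 1)"
      "eps_coords n (fund_weight n) (\<lambda>j. 1)"
      using n by (auto simp: eps_coords_def fund_weight_def minuscule_pair_def)
    then show ?case using k(1) by blast
  next
    case (refl \<mu> i)
    then show ?case using eps_coords_refl[OF n] by blast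
  qed
qed

text \<open>For adjacent nodes the sum of the two simple coroots is again a coroot, whence the last
  bound: no letter is -1 at two adjacent nodes. This keeps adjacent raising operators off the same
  letter.\<close>

lemma mweights_bounds:
  assumes n: "n \<ge> 3" and \<mu>: "\<mu> \<in> mweights n"
  shows "-1 \<le> \<mu> i" "\<mu> i \<le> 1" "i \<notin> {1..n} \<Longrightarrow> \<mu> i = 0"
    "i \<in> {1..n} \<Longrightarrow> j \<in> {1..n} \<Longrightarrow> adjacent_D n i j \<Longrightarrow> -1 \<le> \<mu> i + \<mu> j"
proof -
  obtain x where x: "eps_coords n \<mu> x" using mweights_eps_coords[OF assms] ..
  have r: "2 * \<mu> j = (if j \<in> {1..<n} then x j - x (Suc j) else if j = n then x (n - 1) + x n else 0)" for j
    using x by (simp add: eps_coords_def)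
  have pq: "-2 \<le> x p + x q \<and> x p + x q \<le> 2 \<and> -2 \<le> x p - x q \<and> x p - x q \<le> 2"
    if "p \<in> {1..n}" "q \<in> {1..n}" "p \<noteq> q" for p q
  proof -
    have "minuscule_pair (x p) (x q)" using x that by (simp add: eps_coords_def)
    then show ?thesis by (auto simp: minuscule_pair_def)
  qed
  have "n - 1 \<in> {1..n}" "n \<in> {1..n}" "n - 1 \<noteq> n" using n by auto
  note pqn = pq[OF this]
  have "-1 \<le> \<mu> i \<and> \<mu> i \<le> 1"
    using r[of i] pq[of i "Suc i"] pqn by (auto split: if_splits)
  then show "-1 \<le> \<mu> i" "\<mu> i \<le> 1" by auto
  show "i \<notin> {1..n} \<Longrightarrow> \<mu> i = 0" using r[of i] n by (auto split: if_splits)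
  have *: "-1 \<le> \<mu> i + \<mu> (Suc i)" if "1 \<le> i" "Suc i \<le> n - 1" for i
    using r[of i] r[of "Suc i"] pq[of i "Suc (Suc i)"] that by (auto split: if_splits)
  have **: "-1 \<le> \<mu> (n - 2) + \<mu> n"
  proof -
    have "Suc (n - 2) = n - 1" "n - 2 \<noteq> n" using n by auto
    then show ?thesis
      using r[of "n - 2"] r[of n] pq[of "n - 2" n] n by (auto split: if_splits)
  qed
  show "-1 \<le> \<mu> i + \<mu> j" if "i \<in> {1..n}" "j \<in> {1..n}" "adjacent_D n i j"
    using that *[of i] *[of j] ** by (auto simp: adjacent_D_def add.commute)
qed

lemma mweights_add_root:
  assumes "\<mu> \<in> mweights n" "i \<in> {1..n}" "\<mu> i = - 1"
  shows "(\<lambda>j. \<mu> j + simple_root n i j) \<in> mweights n"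
proof -
  have "(\<lambda>j. \<mu> j + simple_root n i j) = simple_refl n i \<mu>"
    using assms(3) by (simp add: simple_refl_def)
  then show ?thesis using assms by (auto simp: mweights_def intro: weyl_orbit.refl)
qed

lemma mweights_subtract_root:
  assumes "\<mu> \<in> mweights n" "i \<in> {1..n}" "\<mu> i = 1"
  shows "(\<lambda>j. \<mu> j - simple_root n i j) \<in> mweights n"
proof -
  have "(\<lambda>j. \<mu> j - simple_root n i j) = simple_refl n i \<mu>"
    using assms(3) by (simp add: simple_refl_def)
  then show ?thesis using assms by (auto simp: mweights_def intro: weyl_orbit.refl)
qed

text \<open>Four times the coefficients of the half sum of positive coroots in the simple coroots.\<close>

definition height_coeff :: "nat \<Rightarrow> nat \<Rightarrow> int" where
  "height_coeff n i = (if i \<le> n - 2 then 2 * int i * (2 * int n - int i - 1) else int n * (int n - 1))"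

lemma height_coeff_nonneg: "n \<ge> 3 \<Longrightarrow> i \<in> {1..n} \<Longrightarrow> 0 \<le> height_coeff n i"
  by (auto simp: height_coeff_def)

text \<open>The half sum of positive coroots pairs to 1 with every simple root, and the coefficients
  carry a factor of four. Only j and its neighbours contribute to the sum.\<close>

lemma height_simple_root:
  assumes n: "n \<ge> 3" and j: "j \<in> {1..n}"
  shows "(\<Sum>i=1..n. height_coeff n i * simple_root n j i) = 4"
proof -
  let ?c = "height_coeff n"
  have "(\<Sum>i=1..n. ?c i * simple_root n j i) =
      (\<Sum>i\<in>{1..n}. (if i = j then 2 * ?c i else 0) - (if adjacent_D n i j then ?c i else 0))"
    by (rule sum.cong) (auto simp: simple_root_def cartan_D_def adjacent_D_def)
  also have "\<dots> = 2 * ?c j - (\<Sum>i\<in>{i\<in>{1..n}. adjacent_D n i j}. ?c i)"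
    using j by (simp add: sum_subtractf flip: sum.inter_filter)
  also have "\<dots> = 4"
  proof -
    obtain m where m: "n = m + 3" using n by (metis le_add_diff_inverse2)
    \<comment> \<open>With m = n - 3 these are the end of the long arm, its interior, the branch
      node for n = 3 and for n > 3, and the two spin nodes.\<close>
    consider "j \<le> m" "j = 1" | k where "j = k + 2" "k + 2 \<le> m" | "m = 0" "j = 1"
      | k where "m = Suc k" "j = m + 1" | "j = m + 2" | "j = m + 3"
    proof -
      have "(j \<le> m \<and> j = 1) \<or> (\<exists>k. j = k + 2 \<and> k + 2 \<le> m) \<or> (m = 0 \<and> j = 1) \<or>
        (\<exists>k. m = Suc k \<and> j = m + 1) \<or> j = m + 2 \<or> j = m + 3"
        using j unfolding m atLeastAtMost_iff by presburger
      then show ?thesis using that by blast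
    qed
    then show ?thesis
    proof cases
      case 1
      then have "{i\<in>{1..n}. adjacent_D n i j} = {2}" using m by (auto simp: adjacent_D_def)
      then show ?thesis using 1 m by (simp add: height_coeff_def algebra_simps)
    next
      case 2
      then have "{i\<in>{1..n}. adjacent_D n i j} = {k + 1, k + 3}" using m by (auto simp: adjacent_D_def)
      then show ?thesis using 2 m by (simp add: height_coeff_def algebra_simps)
    next
      case 3
      then have "{i\<in>{1..n}. adjacent_D n i j} = {2, 3}" using m by (auto simp: adjacent_D_def)
      then show ?thesis using 3 m by (simp add: height_coeff_def)
    next
      case 4
      then have "{i\<in>{1..n}. adjacent_D n i j} = {k + 1, k + 3, k + 4}" using m by (auto simp: adjacent_D_def)
      then show ?thesis using 4 m by (simp add: height_coeff_def algebra_simps)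
    next
      case 5
      then have "{i\<in>{1..n}. adjacent_D n i j} = {m + 1}" using m by (auto simp: adjacent_D_def)
      then show ?thesis using 5 m by (simp add: height_coeff_def algebra_simps)
    next
      case 6
      then have "{i\<in>{1..n}. adjacent_D n i j} = {m + 1}" using m by (auto simp: adjacent_D_def)
      then show ?thesis using 6 m by (simp add: height_coeff_def algebra_simps)
    qed
  qed
  finally show ?thesis .
qed

section \<open>Words of minuscule weights as paths\<close>

definition path_height :: "nat \<Rightarrow> weight list \<Rightarrow> nat \<Rightarrow> int" where
  "path_height i bs t = (\<Sum>s<t. (bs ! s) i)"

definition add_at :: "nat \<Rightarrow> weight \<Rightarrow> weight list \<Rightarrow> weight list" where
  "add_at t \<alpha> bs = bs[t := (\<lambda>j. (bs ! t) j + \<alpha> j)]"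

lemma path_height_0 [simp]: "path_height i bs 0 = 0"
  by (simp add: path_height_def)

lemma path_height_Suc: "path_height i bs (Suc t) = path_height i bs t + (bs ! t) i"
  by (simp add: path_height_def)

lemma path_height_append:
  "path_height i (bs @ cs) t =
    (if t \<le> length bs then path_height i bs t else path_height i bs (length bs) + path_height i cs (t - length bs))"
proof (induction t)
  case (Suc t)
  then show ?case by (auto simp: path_height_Suc nth_append Suc_diff_le not_le less_Suc_eq_le le_Suc_eq)
qed simp

lemma path_height_append_total: "path_height i (bs @ cs) (length bs + t) = path_height i bs (length bs) + path_height i cs t"
  by (simp add: path_height_append)

lemma length_add_at [simp]: "length (add_at t \<alpha> bs) = length bs"
  by (simp add: add_at_def)

lemma path_height_add_at:
  "u < length bs \<Longrightarrow> path_height i (add_at u \<alpha> bs) t = path_height i bs t + (if u < t then \<alpha> i else 0)"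
  by (induction t) (auto simp: path_height_Suc add_at_def less_Suc_eq)

lemma add_at_commute:
  "u < length bs \<Longrightarrow> v < length bs \<Longrightarrow> add_at u \<alpha> (add_at v \<beta> bs) = add_at v \<beta> (add_at u \<alpha> bs)"
  by (auto simp: add_at_def list_eq_iff_nth_eq nth_list_update add_ac)

lemma add_at_inverse: "t < length bs \<Longrightarrow> add_at t \<alpha> (add_at t (\<lambda>j. - \<alpha> j) bs) = bs"
  by (simp add: add_at_def)

lemma add_at_append:
  "t < length bs \<Longrightarrow> add_at t \<alpha> (bs @ cs) = add_at t \<alpha> bs @ cs"
  "add_at (length bs + t) \<alpha> (bs @ cs) = bs @ add_at t \<alpha> cs"
  by (auto simp: add_at_def list_update_append nth_append)

text \<open>Crystal operators in the path model: a word of weights is viewed through its \<open>i\<close>-heights, and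
  \<open>e\<^sub>i\<close> changes the letter whose step first reaches the minimum, \<open>f\<^sub>i\<close> the one whose step leaves it for
  the last time.\<close>

definition path_min :: "nat \<Rightarrow> weight list \<Rightarrow> int" where
  "path_min i bs = Min (path_height i bs ` {..length bs})"

lemma path_min_le: "t \<le> length bs \<Longrightarrow> path_min i bs \<le> path_height i bs t"
  by (simp add: path_min_def)

lemma path_min_attained: "\<exists>t\<le>length bs. path_height i bs t = path_min i bs"
proof -
  have "path_min i bs \<in> path_height i bs ` {..length bs}" unfolding path_min_def by (rule Min_in) auto
  then show ?thesis by auto
qed

lemma path_min_nonpos: "path_min i bs \<le> 0"
  using path_min_le[of 0 bs i] by simp

lemma path_min_eqI: "(\<And>t. t \<le> length bs \<Longrightarrow> m \<le> path_height i bs t) \<Longrightarrow>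
  t \<le> length bs \<Longrightarrow> path_height i bs t = m \<Longrightarrow> path_min i bs = m"
  unfolding path_min_def by (rule Min_eqI) auto

lemma path_min_append: "path_min i (bs @ cs) = min (path_min i bs) (path_height i bs (length bs) + path_min i cs)"
proof -
  obtain s t where st: "s \<le> length bs" "path_height i bs s = path_min i bs" "t \<le> length cs" "path_height i cs t = path_min i cs"
    using path_min_attained by meson
  have lb: "min (path_min i bs) (path_height i bs (length bs) + path_min i cs) \<le> path_height i (bs @ cs) u"
    if "u \<le> length (bs @ cs)" for u
  proof -
    have "u - length bs \<le> length cs" using that by simp
    then show ?thesis
      using path_min_le[of u bs i] path_min_le[of "u - length bs" cs i] that by (auto simp: path_height_append)
  qed
  show ?thesis
  proof (cases "path_min i bs \<le> path_height i bs (length bs) + path_min i cs")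
    case True
    show ?thesis by (rule path_min_eqI[OF lb, of s]) (use True st in \<open>auto simp: path_height_append\<close>)
  next
    case False
    show ?thesis
      by (rule path_min_eqI[OF lb, of "length bs + t"]) (use False st in \<open>auto simp: path_height_append\<close>)
  qed
qed

section \<open>First and last minima of a path\<close>

definition first_min_step :: "nat \<Rightarrow> weight list \<Rightarrow> nat \<Rightarrow> bool" where
  "first_min_step i bs t \<longleftrightarrow> t < length bs \<and> path_height i bs (Suc t) = path_min i bs \<and>
    (\<forall>s\<le>t. path_min i bs < path_height i bs s)"

definition last_min_step :: "nat \<Rightarrow> weight list \<Rightarrow> nat \<Rightarrow> bool" where
  "last_min_step i bs t \<longleftrightarrow> t < length bs \<and> path_height i bs t = path_min i bs \<and>
    (\<forall>s. t < s \<and> s \<le> length bs \<longrightarrow> path_min i bs < path_height i bs s)"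

lemma first_min_step_unique: "first_min_step i bs s \<Longrightarrow> first_min_step i bs t \<Longrightarrow> s = t"
  unfolding first_min_step_def by (metis Suc_leI less_irrefl linorder_neqE_nat)

lemma last_min_step_unique: "last_min_step i bs s \<Longrightarrow> last_min_step i bs t \<Longrightarrow> s = t"
  unfolding last_min_step_def by (metis less_imp_le less_irrefl linorder_neqE_nat)

lemma first_min_step_exists: "(\<exists>t. first_min_step i bs t) \<longleftrightarrow> path_min i bs < 0"
proof
  assume "\<exists>t. first_min_step i bs t"
  then obtain t where "first_min_step i bs t" ..
  then have "path_min i bs < path_height i bs 0" unfolding first_min_step_def by blast
  then show "path_min i bs < 0" by simp
next
  assume neg: "path_min i bs < 0"
  define s where "s = (LEAST s. path_height i bs s = path_min i bs)"
  obtain r where r: "r \<le> length bs" "path_height i bs r = path_min i bs" using path_min_attained by blast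
  have s: "path_height i bs s = path_min i bs" "s \<le> r" unfolding s_def using r by (auto intro: LeastI Least_le)
  obtain t where t: "s = Suc t" using s neg by (cases s) auto
  have "path_min i bs < path_height i bs u" if "u \<le> t" for u
  proof -
    have "path_height i bs u \<noteq> path_min i bs"
      using not_less_Least[of u "\<lambda>s. path_height i bs s = path_min i bs"] that t s_def by simp
    then show ?thesis using path_min_le[of u bs i] that t s r by simp
  qed
  then have "first_min_step i bs t" unfolding first_min_step_def using s t r by auto
  then show "\<exists>t. first_min_step i bs t" ..
qed

lemma last_min_step_exists: "(\<exists>t. last_min_step i bs t) \<longleftrightarrow> path_min i bs < path_height i bs (length bs)"
proof
  assume "\<exists>t. last_min_step i bs t"
  then obtain t where "last_min_step i bs t" ..
  then show "path_min i bs < path_height i bs (length bs)" unfolding last_min_step_def by blast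
next
  assume neg: "path_min i bs < path_height i bs (length bs)"
  let ?S = "{s. s \<le> length bs \<and> path_height i bs s = path_min i bs}"
  have fin: "finite ?S" by simp
  have ne: "?S \<noteq> {}" using path_min_attained by blast
  have t: "Max ?S \<in> ?S" using Max_in[OF fin ne] .
  have "path_min i bs < path_height i bs s" if "Max ?S < s" "s \<le> length bs" for s
  proof -
    have "s \<notin> ?S" using Max_ge[OF fin] that by (meson leD)
    then show ?thesis using path_min_le[of s bs i] that by simp
  qed
  moreover have "Max ?S \<noteq> length bs" using t neg by auto
  ultimately have "last_min_step i bs (Max ?S)" using t unfolding last_min_step_def by auto
  then show "\<exists>t. last_min_step i bs t" ..
qed

definition path_e :: "nat \<Rightarrow> nat \<Rightarrow> weight list \<Rightarrow> weight list option" where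
  "path_e n i bs = (if \<exists>t. first_min_step i bs t then Some (add_at (THE t. first_min_step i bs t) (simple_root n i) bs) else None)"

definition path_f :: "nat \<Rightarrow> nat \<Rightarrow> weight list \<Rightarrow> weight list option" where
  "path_f n i bs =
    (if \<exists>t. last_min_step i bs t then Some (add_at (THE t. last_min_step i bs t) (\<lambda>j. - simple_root n i j) bs) else None)"

lemma path_e_first_min_step: "first_min_step i bs t \<Longrightarrow> path_e n i bs = Some (add_at t (simple_root n i) bs)"
  unfolding path_e_def using first_min_step_unique by (metis the_equality)

lemma path_f_last_min_step: "last_min_step i bs t \<Longrightarrow> path_f n i bs = Some (add_at t (\<lambda>j. - simple_root n i j) bs)"
  unfolding path_f_def using last_min_step_unique by (metis the_equality)

lemma path_e_None: "path_e n i bs = None \<longleftrightarrow> path_min i bs = 0"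
  using path_min_nonpos[of i bs] by (auto simp: path_e_def first_min_step_exists)

lemma path_f_None: "path_f n i bs = None \<longleftrightarrow> path_min i bs = path_height i bs (length bs)"
  using path_min_le[of "length bs" bs i] by (auto simp: path_f_def last_min_step_exists)

lemma path_e_None_iff: "path_e n i bs = None \<longleftrightarrow> (\<forall>t\<le>length bs. 0 \<le> path_height i bs t)"
  unfolding path_e_None using path_min_le[of _ bs i] path_min_attained[of bs i] path_min_nonpos[of i bs] by force

lemma path_e_SomeE:
  assumes "path_e n i bs = Some cs"
  obtains t where "first_min_step i bs t" "cs = add_at t (simple_root n i) bs"
  using assms path_e_first_min_step by (metis option.distinct(1) option.inject path_e_def)

lemma path_f_SomeE:
  assumes "path_f n i bs = Some cs"
  obtains t where "last_min_step i bs t" "cs = add_at t (\<lambda>j. - simple_root n i j) bs"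
  using assms path_f_last_min_step by (metis option.distinct(1) option.inject path_f_def)

text \<open>This is the tensor rule: \<open>- path_min\<close> plays the role of \<epsilon>, total
  minus minimum that of \<phi>, and the test says that \<phi> of the left part is at least
  \<epsilon> of the right part. A tie goes to the left because the first minimum counts.\<close>

lemma path_e_append:
  "path_e n i (bs @ cs) =
    (if path_min i bs \<le> path_height i bs (length bs) + path_min i cs then map_option (\<lambda>xs. xs @ cs) (path_e n i bs)
     else map_option (\<lambda>xs. bs @ xs) (path_e n i cs))"
proof (cases "path_min i bs \<le> path_height i bs (length bs) + path_min i cs")
  case True
  then have path_min: "path_min i (bs @ cs) = path_min i bs" by (simp add: path_min_append)
  show ?thesis
  proof (cases "path_min i bs = 0")
    case True
    then have "path_e n i bs = None" "path_e n i (bs @ cs) = None" by (simp_all add: path_e_None path_min)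
    then show ?thesis using \<open>path_min i bs \<le> _\<close> by simp
  next
    case False
    then obtain t where t: "first_min_step i bs t" using first_min_step_exists[of i bs] path_min_nonpos[of i bs] by force
    then have "first_min_step i (bs @ cs) t" unfolding first_min_step_def path_min by (auto simp: path_height_append)
    from path_e_first_min_step[OF this] path_e_first_min_step[OF t] show ?thesis
      using True t by (simp add: add_at_append first_min_step_def)
  qed
next
  case False
  then have path_min: "path_min i (bs @ cs) = path_height i bs (length bs) + path_min i cs" by (simp add: path_min_append)
  have "path_min i cs < 0" using False path_min_le[of "length bs" bs i] by simp
  then obtain t where t: "first_min_step i cs t" using first_min_step_exists[of i cs] by blast
  have "first_min_step i (bs @ cs) (length bs + t)"
    unfolding first_min_step_def path_min
  proof (intro conjI allI impI)
    fix s assume "s \<le> length bs + t"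
    then show "path_height i bs (length bs) + path_min i cs < path_height i (bs @ cs) s"
      using t False path_min_le[of s bs i] unfolding first_min_step_def by (auto simp: path_height_append)
  qed (use t in \<open>auto simp: first_min_step_def path_height_append\<close>)
  from path_e_first_min_step[OF this] path_e_first_min_step[OF t] show ?thesis
    using False by (simp add: add_at_append)
qed

text \<open>Now the last minimum counts, so a tie goes to the right and the test is strict.\<close>

lemma path_f_append:
  "path_f n i (bs @ cs) =
    (if path_min i bs < path_height i bs (length bs) + path_min i cs then map_option (\<lambda>xs. xs @ cs) (path_f n i bs)
     else map_option (\<lambda>xs. bs @ xs) (path_f n i cs))"
proof (cases "path_min i bs < path_height i bs (length bs) + path_min i cs")
  case True
  then have path_min: "path_min i (bs @ cs) = path_min i bs" by (simp add: path_min_append)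
  obtain t where t: "last_min_step i bs t"
    using last_min_step_exists[of i bs] True path_min_nonpos[of i cs] by auto
  have "last_min_step i (bs @ cs) t"
    unfolding last_min_step_def path_min
  proof (intro conjI allI impI)
    fix s assume s: "t < s \<and> s \<le> length (bs @ cs)"
    then have "s - length bs \<le> length cs" by auto
    then show "path_min i bs < path_height i (bs @ cs) s"
      using s
      using t True path_min_le[of "s - length bs" cs i] unfolding last_min_step_def by (auto simp: path_height_append)
  qed (use t in \<open>auto simp: last_min_step_def path_height_append\<close>)
  from path_f_last_min_step[OF this] path_f_last_min_step[OF t] show ?thesis
    using True t by (simp add: add_at_append last_min_step_def)
next
  case False
  then have path_min: "path_min i (bs @ cs) = path_height i bs (length bs) + path_min i cs" by (simp add: path_min_append)
  show ?thesis
  proof (cases "path_min i cs = path_height i cs (length cs)")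
    case True
    then have "path_f n i cs = None" "path_f n i (bs @ cs) = None" by (auto simp: path_f_None path_min path_height_append)
    then show ?thesis using False by simp
  next
    case nz: False
    then obtain t where t: "last_min_step i cs t" using last_min_step_exists[of i cs] path_min_le[of "length cs" cs i] by force
    have "last_min_step i (bs @ cs) (length bs + t)"
      unfolding last_min_step_def path_min
    proof (intro conjI allI impI)
      fix s assume s: "length bs + t < s \<and> s \<le> length (bs @ cs)"
      then have "t < s - length bs \<and> s - length bs \<le> length cs" by auto
      then show "path_height i bs (length bs) + path_min i cs < path_height i (bs @ cs) s"
        using t s unfolding last_min_step_def by (auto simp: path_height_append)
    qed (use t in \<open>auto simp: last_min_step_def path_height_append\<close>)
    from path_f_last_min_step[OF this] path_f_last_min_step[OF t] show ?thesis
      using False by (simp add: add_at_append)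
  qed
qed

context
  fixes n :: nat
  assumes n: "n \<ge> 3"
begin

text \<open>A step of size at most one cannot jump over a value, so the letter that first reaches
  the minimum comes from exactly one above it.\<close>

lemma first_min_step_step:
  assumes "set bs \<subseteq> mweights n" "first_min_step i bs t"
  shows "(bs ! t) i = -1" "path_height i bs t = path_min i bs + 1" "i \<in> {1..n}" "t < length bs"
proof -
  have t: "t < length bs" "bs ! t \<in> mweights n" using assms by (auto simp: first_min_step_def)
  show *: "(bs ! t) i = -1" "path_height i bs t = path_min i bs + 1"
    using assms(2) mweights_bounds(1)[OF n t(2), of i] path_height_Suc[of i bs t] unfolding first_min_step_def by force+
  then show "i \<in> {1..n}" using mweights_bounds(3)[OF n t(2), of i] by fastforce
  show "t < length bs" by fact
qed

lemma last_min_step_step: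
  assumes "set bs \<subseteq> mweights n" "last_min_step i bs t"
  shows "(bs ! t) i = 1" "path_height i bs (Suc t) = path_min i bs + 1" "i \<in> {1..n}" "t < length bs"
proof -
  have t: "t < length bs" "bs ! t \<in> mweights n" using assms by (auto simp: last_min_step_def)
  have "path_min i bs < path_height i bs (Suc t)" using assms(2) unfolding last_min_step_def by simp
  then show *: "(bs ! t) i = 1" "path_height i bs (Suc t) = path_min i bs + 1"
    using assms(2) mweights_bounds(2)[OF n t(2), of i] path_height_Suc[of i bs t] unfolding last_min_step_def by force+
  then show "i \<in> {1..n}" using mweights_bounds(3)[OF n t(2), of i] by fastforce
  show "t < length bs" by fact
qed

lemma path_e_mweights:
  assumes "set bs \<subseteq> mweights n" "path_e n i bs = Some cs"
  shows "set cs \<subseteq> mweights n" "length cs = length bs" "i \<in> {1..n}" "path_min i cs = path_min i bs + 1"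
    "path_height j cs (length cs) = path_height j bs (length bs) + simple_root n i j"
proof -
  obtain t where t: "first_min_step i bs t" "cs = add_at t (simple_root n i) bs" using assms(2) by (rule path_e_SomeE)
  note s = first_min_step_step[OF assms(1) t(1)]
  show "i \<in> {1..n}" by fact
  show "length cs = length bs" using t by simp
  have "(\<lambda>j. (bs ! t) j + simple_root n i j) \<in> mweights n"
    using mweights_add_root s assms(1) by (meson nth_mem subsetD)
  then show "set cs \<subseteq> mweights n" unfolding t(2) add_at_def using assms(1) by (auto dest: set_update_subset_insert[THEN subsetD])
  show "path_height j cs (length cs) = path_height j bs (length bs) + simple_root n i j"
    using t s by (simp add: path_height_add_at)
  \<comment> \<open>The new minimum sits just before the raised letter: earlier heights exceed the
    old minimum, later ones rise by two.\<close>
  show "path_min i cs = path_min i bs + 1"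
  proof (rule path_min_eqI[where t = t])
    fix u assume "u \<le> length cs"
    then show "path_min i bs + 1 \<le> path_height i cs u"
      using t s path_min_le[of u bs i] simple_root_self[OF s(3)] unfolding first_min_step_def
      by (cases "u \<le> t") (auto simp: path_height_add_at)
  qed (use t s in \<open>auto simp: path_height_add_at\<close>)
qed

lemma path_f_mweights:
  assumes "set bs \<subseteq> mweights n" "path_f n i bs = Some cs"
  shows "set cs \<subseteq> mweights n" "length cs = length bs" "i \<in> {1..n}" "path_min i cs = path_min i bs - 1"
    "path_height j cs (length cs) = path_height j bs (length bs) - simple_root n i j" "path_e n i cs = Some bs"
proof -
  obtain t where t: "last_min_step i bs t" "cs = add_at t (\<lambda>j. - simple_root n i j) bs"
    using assms(2) by (rule path_f_SomeE)
  note s = last_min_step_step[OF assms(1) t(1)]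
  show "i \<in> {1..n}" by fact
  show "length cs = length bs" using t by simp
  have "(\<lambda>j. (bs ! t) j - simple_root n i j) \<in> mweights n"
    using mweights_subtract_root s assms(1) by (meson nth_mem subsetD)
  then show "set cs \<subseteq> mweights n" unfolding t(2) add_at_def using assms(1) by (auto dest: set_update_subset_insert[THEN subsetD])
  show "path_height j cs (length cs) = path_height j bs (length bs) - simple_root n i j"
    using t s by (simp add: path_height_add_at)
  show path_min: "path_min i cs = path_min i bs - 1"
  proof (rule path_min_eqI[where t = "Suc t"])
    fix u assume "u \<le> length cs"
    then show "path_min i bs - 1 \<le> path_height i cs u"
      using t s path_min_le[of u bs i] simple_root_self[OF s(3)] unfolding last_min_step_def
      by (cases "t < u") (auto simp: path_height_add_at)
  qed (use t s simple_root_self[OF s(3)] in \<open>auto simp: path_height_add_at\<close>)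
  \<comment> \<open>Heights up to t are unchanged, hence not below the old minimum; the lowered
    letter is thus the first to reach the new one, and raising changes it back.\<close>
  have "first_min_step i cs t"
    unfolding first_min_step_def path_min using t s path_min_le[of _ bs i] simple_root_self[OF s(3)]
    by (auto simp: path_height_add_at intro: less_le_trans[of "path_min i bs - 1" "path_min i bs"])
  from path_e_first_min_step[OF this, of n] show "path_e n i cs = Some bs" using t s by (simp add: add_at_inverse)
qed

end

section \<open>Confluence of the raising operators\<close>

definition raising :: "nat \<Rightarrow> nat set \<Rightarrow> (weight list \<times> weight list) set" where
  "raising n J = {(bs, cs). set bs \<subseteq> mweights n \<and> (\<exists>i\<in>J. path_e n i bs = Some cs)}"

definition highest :: "nat set \<Rightarrow> weight list \<Rightarrow> bool" where
  "highest J bs \<longleftrightarrow> (\<forall>i\<in>J. \<forall>t\<le>length bs. 0 \<le> path_height i bs t)"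

definition linked :: "nat \<Rightarrow> weight list \<Rightarrow> weight list \<Rightarrow> bool" where
  "linked n bs cs \<longleftrightarrow> (bs, cs) \<in> (raising n UNIV \<union> (raising n UNIV)\<inverse>)\<^sup>*"

text \<open>Four times the pairing of the total weight with the half sum of positive
  coroots.\<close>

definition height :: "nat \<Rightarrow> weight list \<Rightarrow> int" where
  "height n bs = (\<Sum>i=1..n. height_coeff n i * path_height i bs (length bs))"

text \<open>Avoids \<open>path_min\<close>, whose value shifts whenever a letter is changed; only
  heights are compared.\<close>

lemma first_min_stepI:
  assumes "t < length bs" "\<And>u. u \<le> t \<Longrightarrow> path_height i bs (Suc t) < path_height i bs u"
    "\<And>u. t < u \<Longrightarrow> u \<le> length bs \<Longrightarrow> path_height i bs (Suc t) \<le> path_height i bs u"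
  shows "first_min_step i bs t"
proof -
  have "path_height i bs (Suc t) \<le> path_height i bs u" if "u \<le> length bs" for u
    using assms(2)[of u] assms(3)[of u] that by linarith
  then have "path_min i bs = path_height i bs (Suc t)"
    using assms(1) by (intro path_min_eqI[where t = "Suc t"]) auto
  then show ?thesis using assms by (simp add: first_min_step_def)
qed

lemma highest_iff: "highest J bs \<longleftrightarrow> (\<forall>i\<in>J. path_e n i bs = None)"
  by (simp add: highest_def path_e_None_iff)

lemma linked_sym: "linked n bs cs \<Longrightarrow> linked n cs bs"
  unfolding linked_def
  by (metis (no_types, lifting) Un_commute converse_Un converse_converse rtrancl_converseD)

lemma linked_trans: "linked n xs ys \<Longrightarrow> linked n ys zs \<Longrightarrow> linked n xs zs"
  unfolding linked_def by (rule rtrancl_trans)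

lemma raising_linked:
  assumes "(bs, cs) \<in> (raising n J)\<^sup>*"
  shows "linked n bs cs"
proof -
  have "raising n J \<subseteq> raising n UNIV \<union> (raising n UNIV)\<inverse>" by (auto simp: raising_def)
  then show ?thesis unfolding linked_def using assms rtrancl_mono by blast
qed

context
  fixes n :: nat
  assumes n: "n \<ge> 3"
begin

lemma raising_mweights:
  assumes "(bs, cs) \<in> (raising n J)\<^sup>*" "set bs \<subseteq> mweights n"
  shows "set cs \<subseteq> mweights n" "length cs = length bs"
  using assms by (induction) (auto simp: raising_def dest: path_e_mweights(1,2)[OF n])

text \<open>If raising along \<open>j\<close> creates a new first minimum for \<open>i\<close> at \<open>r\<close>, then the two raised words are not
  joined by a square but by the Stembridge relation of degree four, where \<open>v\<close> is the second letter
  raised along \<open>j\<close>.\<close>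

lemma local_confluence_adjacent:
  assumes bs: "set bs \<subseteq> mweights n" and i: "i \<in> {1..n}" and j: "j \<in> {1..n}"
    and ij: "simple_root n i j = -1" "simple_root n j i = -1"
    and first_min_step_i: "first_min_step i bs t" and first_min_step_j: "first_min_step j bs s" and ts: "t < s"
  shows "\<exists>zs. (add_at t (simple_root n i) bs, zs) \<in> (raising n UNIV)\<^sup>* \<and>
    (add_at s (simple_root n j) bs, zs) \<in> (raising n UNIV)\<^sup>*"
proof -
  let ?A = "simple_root n i" and ?B = "simple_root n j"
  let ?x = "add_at t ?A bs" and ?y = "add_at s ?B bs"
  note roots = ij simple_root_self[OF i] simple_root_self[OF j]
  define p q where "p = path_min i bs" and "q = path_min j bs"
  have s: "s < length bs" and t: "t < length bs" using first_min_step_i first_min_step_j by (auto simp: first_min_step_def)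
  have hi: "\<And>u. u \<le> t \<Longrightarrow> p < path_height i bs u"
    "\<And>u. u \<le> length bs \<Longrightarrow> p \<le> path_height i bs u" "path_height i bs (Suc t) = p"
    using first_min_step_i path_min_le[of _ bs i] by (auto simp: first_min_step_def p_def)
  have hj: "\<And>u. u \<le> s \<Longrightarrow> q < path_height j bs u"
    "\<And>u. u \<le> length bs \<Longrightarrow> q \<le> path_height j bs u" "path_height j bs (Suc s) = q"
    "path_height j bs s = q + 1"
    using first_min_step_j path_min_le[of _ bs j] first_min_step_step[OF n bs first_min_step_j] by (auto simp: first_min_step_def q_def)
  have step: "(bs', add_at u (simple_root n k) bs') \<in> raising n UNIV"
    if "first_min_step k bs' u" "set bs' \<subseteq> mweights n" for bs' k u
    using path_e_first_min_step[OF that(1), of n] that(2) by (auto simp: raising_def)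
  have mw: "set (add_at u (simple_root n k) bs') \<subseteq> mweights n"
    if "first_min_step k bs' u" "set bs' \<subseteq> mweights n" for bs' k u
    using path_e_mweights(1)[OF n that(2) path_e_first_min_step[OF that(1), of n]] .
  have x: "set ?x \<subseteq> mweights n" and y: "set ?y \<subseteq> mweights n"
    using mw first_min_step_i first_min_step_j bs by auto
  \<comment> \<open>Raising letter t along i lowers all j-heights after t by one. The j-minimum at s
    lies there and stays the first one.\<close>
  have lx: "first_min_step j ?x s"
  proof (rule first_min_stepI)
    fix u
    show "u \<le> s \<Longrightarrow> path_height j ?x (Suc s) < path_height j ?x u"
      using hj(1)[of u] hj(3) ts t roots by (auto simp: path_height_add_at)
    show "s < u \<Longrightarrow> u \<le> length ?x \<Longrightarrow> path_height j ?x (Suc s) \<le> path_height j ?x u"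
      using hj(2)[of u] hj(3) ts t roots by (auto simp: path_height_add_at)
  qed (use s in auto)
  show ?thesis
  proof (cases "\<exists>u. s < u \<and> u \<le> length bs \<and> path_height i bs u = p")
    \<comment> \<open>The j-step lowers the i-heights after s by one. All of them exceed p, so none
      falls below p, t stays the first i-minimum, and the two operators commute.\<close>
    case False
    then have hi': "p < path_height i bs u" if "s < u" "u \<le> length bs" for u
      using hi(2)[of u] that by force
    have ly: "first_min_step i ?y t"
    proof (rule first_min_stepI)
      fix u
      show "u \<le> t \<Longrightarrow> path_height i ?y (Suc t) < path_height i ?y u"
        using hi(1)[of u] hi(3) ts s roots by (auto simp: path_height_add_at)
      show "t < u \<Longrightarrow> u \<le> length ?y \<Longrightarrow> path_height i ?y (Suc t) \<le> path_height i ?y u"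
        using hi(2)[of u] hi'[of u] hi(3) ts s roots by (auto simp: path_height_add_at)
    qed (use t in auto)
    have "add_at s ?B ?x = add_at t ?A ?y" using add_at_commute s t by simp
    then show ?thesis using step[OF lx x] step[OF ly y] by auto
  next
    case True
    \<comment> \<open>Letter r is the first from s on whose step returns to the i-minimum. That
      height drops to p - 1 in \<open>?y\<close>, so the i-operator acts at r before it acts at
      t.\<close>
    define P where "P u \<longleftrightarrow> s < u \<and> u \<le> length bs \<and> path_height i bs u = p" for u
    have "P (LEAST u. P u)" using True by (auto simp flip: P_def intro: LeastI)
    moreover from this obtain r where r: "Suc r = (LEAST u. P u)"
      unfolding P_def by (metis (no_types, lifting) less_nat_zero_code not0_implies_Suc)
    ultimately have "P (Suc r)" by simp
    then have r': "s \<le> r" "r < length bs" "path_height i bs (Suc r) = p" by (auto simp: P_def)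
    have hr: "p < path_height i bs u" if "s < u" "u \<le> r" for u
    proof -
      have "\<not> P u" using not_less_Least[of u P] that unfolding r[symmetric] by auto
      then show ?thesis using hi(2)[of u] that r' by (force simp: P_def)
    qed
    \<comment> \<open>In \<open>?x1\<close> the j-heights between t and s are lowered by one and
      those after s raised by one. The minimum is then q, first reached where the original height
      first equals q + 1 after t.\<close>
    define Q where "Q u \<longleftrightarrow> t < u \<and> u \<le> s \<and> path_height j bs u = q + 1" for u
    have "Q s" using ts hj(4) by (simp add: Q_def)
    then have Q': "Q (LEAST u. Q u)" by (rule LeastI)
    then obtain v where v: "Suc v = (LEAST u. Q u)" unfolding Q_def
      by (metis (no_types, lifting) less_nat_zero_code not0_implies_Suc)
    have v': "t \<le> v" "v < s" "path_height j bs (Suc v) = q + 1" using Q'[folded v] by (auto simp: Q_def)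
    have hv: "q + 1 < path_height j bs u" if "t < u" "u \<le> v" for u
    proof -
      have "\<not> Q u" using not_less_Least[of u Q] that unfolding v[symmetric] by auto
      then show ?thesis using hj(1)[of u] that v' by (force simp: Q_def)
    qed
    have vl: "v < length bs" using v' s by simp
    \<comment> \<open>Counting from \<open>bs\<close>, one branch raises along j, i, i, j at s, r,
      t, v and the other along i, j, j, i at t, s, v, r: the same four changes in different
      orders.\<close>
    let ?y1 = "add_at r ?A ?y"
    let ?y2 = "add_at t ?A ?y1"
    let ?y3 = "add_at v ?B ?y2"
    let ?x1 = "add_at s ?B ?x"
    let ?x2 = "add_at v ?B ?x1"
    let ?x3 = "add_at r ?A ?x2"
    have l1: "first_min_step i ?y r"
    proof (rule first_min_stepI)
      fix u
      show "u \<le> r \<Longrightarrow> path_height i ?y (Suc r) < path_height i ?y u"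
        using hr[of u] r' s roots hi(2)[of u] by (cases "u \<le> s") (auto simp: path_height_add_at)
      show "r < u \<Longrightarrow> u \<le> length ?y \<Longrightarrow> path_height i ?y (Suc r) \<le> path_height i ?y u"
        using hi(2)[of u] r' s roots by (auto simp: path_height_add_at)
    qed (use r' in auto)
    have l2: "first_min_step i ?y1 t"
    proof (rule first_min_stepI)
      fix u
      show "u \<le> t \<Longrightarrow> path_height i ?y1 (Suc t) < path_height i ?y1 u"
        using hi(1)[of u] hi(3) r' ts s roots by (auto simp: path_height_add_at)
      show "t < u \<Longrightarrow> u \<le> length ?y1 \<Longrightarrow> path_height i ?y1 (Suc t) \<le> path_height i ?y1 u"
        using hi(2)[of u] hr[of u] hi(3) r' ts s roots by (cases "u \<le> r") (auto simp: path_height_add_at)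
    qed (use t in auto)
    have l3: "first_min_step j ?y2 v"
    proof (rule first_min_stepI)
      fix u
      show "u \<le> v \<Longrightarrow> path_height j ?y2 (Suc v) < path_height j ?y2 u"
        using hj(1)[of u] hv[of u] v' r' ts t s roots by (cases "u \<le> t") (auto simp: path_height_add_at)
      show "v < u \<Longrightarrow> u \<le> length ?y2 \<Longrightarrow> path_height j ?y2 (Suc v) \<le> path_height j ?y2 u"
        using hj(1)[of u] hj(2)[of u] v' r' ts t s roots by (cases "u \<le> s") (auto simp: path_height_add_at)
    qed (use vl in auto)
    have l4: "first_min_step j ?x1 v"
    proof (rule first_min_stepI)
      fix u
      show "u \<le> v \<Longrightarrow> path_height j ?x1 (Suc v) < path_height j ?x1 u"
        using hj(1)[of u] hv[of u] v' ts t s roots by (cases "u \<le> t") (auto simp: path_height_add_at)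
      show "v < u \<Longrightarrow> u \<le> length ?x1 \<Longrightarrow> path_height j ?x1 (Suc v) \<le> path_height j ?x1 u"
        using hj(1)[of u] hj(2)[of u] v' ts t s roots by (cases "u \<le> s") (auto simp: path_height_add_at)
    qed (use vl in auto)
    have l5: "first_min_step i ?x2 r"
    proof (rule first_min_stepI)
      fix u
      consider "u \<le> t" | "t < u" "u \<le> v" | "v < u" "u \<le> s" | "s < u" by linarith
      then show "u \<le> r \<Longrightarrow> path_height i ?x2 (Suc r) < path_height i ?x2 u"
        using hi(1)[of u] hi(2)[of u] hr[of u] v' r' ts t s roots by cases (auto simp: path_height_add_at)
      show "r < u \<Longrightarrow> u \<le> length ?x2 \<Longrightarrow> path_height i ?x2 (Suc r) \<le> path_height i ?x2 u"
        using hi(2)[of u] v' r' ts t s roots by (auto simp: path_height_add_at)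
    qed (use r' in auto)
    have y1: "set ?y1 \<subseteq> mweights n" using mw[OF l1 y] .
    have y2: "set ?y2 \<subseteq> mweights n" using mw[OF l2 y1] .
    have x1: "set ?x1 \<subseteq> mweights n" using mw[OF lx x] .
    have x2: "set ?x2 \<subseteq> mweights n" using mw[OF l4 x1] .
    have "(?y, ?y3) \<in> (raising n UNIV)\<^sup>*"
      using step[OF l1 y] step[OF l2 y1] step[OF l3 y2] by (meson rtrancl.simps)
    moreover have "(?x, ?x3) \<in> (raising n UNIV)\<^sup>*"
      using step[OF lx x] step[OF l4 x1] step[OF l5 x2] by (meson rtrancl.simps)
    moreover have "?x3 = ?y3"
    proof -
      have "?x3 = add_at v ?B (add_at r ?A ?x1)"
        by (rule add_at_commute) (use r'(2) vl in auto)
      moreover have "?x1 = add_at t ?A ?y" by (rule add_at_commute) (use s t in auto)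
      moreover have "add_at r ?A (add_at t ?A ?y) = ?y2" by (rule add_at_commute) (use r'(2) t in auto)
      ultimately show ?thesis by simp
    qed
    ultimately show ?thesis by metis
  qed
qed

text \<open>Non-adjacent colours leave each other's heights alone, so they commute even when acting
  on the same letter. Adjacent colours act on different letters.\<close>

lemma local_confluence:
  assumes "(bs, xs) \<in> raising n UNIV" "(bs, ys) \<in> raising n UNIV"
  shows "\<exists>zs. (xs, zs) \<in> (raising n UNIV)\<^sup>* \<and> (ys, zs) \<in> (raising n UNIV)\<^sup>*"
proof -
  obtain i j where bs: "set bs \<subseteq> mweights n" and ij: "path_e n i bs = Some xs" "path_e n j bs = Some ys"
    using assms by (auto simp: raising_def)
  obtain t where t: "first_min_step i bs t" "xs = add_at t (simple_root n i) bs" using ij(1) by (rule path_e_SomeE)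
  obtain s where s: "first_min_step j bs s" "ys = add_at s (simple_root n j) bs" using ij(2) by (rule path_e_SomeE)
  note t' = first_min_step_step[OF n bs t(1)] and s' = first_min_step_step[OF n bs s(1)]
  have xs: "set xs \<subseteq> mweights n" and ys: "set ys \<subseteq> mweights n"
    using path_e_mweights(1)[OF n bs] ij by auto
  note comm = simple_root_commute[OF t'(3) s'(3)]
  consider "i = j" | "i \<noteq> j" "simple_root n i j = 0" | "simple_root n i j = -1" "adjacent_D n j i"
    using simple_root_cases[OF t'(3), of j] by blast
  then show ?thesis
  proof cases
    case 1
    then show ?thesis using ij by auto
  next
    case 2
    have "first_min_step j xs s" "first_min_step i ys t"
      unfolding t(2) s(2)
      using s(1)[unfolded first_min_step_def] t(1)[unfolded first_min_step_def] 2 comm path_min_le[of _ bs i] path_min_le[of _ bs j]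
      by (intro first_min_stepI; simp add: path_height_add_at)+
    then have "path_e n j xs = Some (add_at s (simple_root n j) xs)" "path_e n i ys = Some (add_at t (simple_root n i) ys)"
      by (simp_all add: path_e_first_min_step)
    moreover have "add_at s (simple_root n j) xs = add_at t (simple_root n i) ys"
      unfolding t(2) s(2) using t'(4) s'(4) by (simp add: add_at_commute)
    ultimately have "(xs, add_at t (simple_root n i) ys) \<in> raising n UNIV"
      "(ys, add_at t (simple_root n i) ys) \<in> raising n UNIV"
      using xs ys unfolding raising_def by auto
    then show ?thesis by blast
  next
    case 3
    \<comment> \<open>A common letter would be -1 at both adjacent nodes.\<close>
    have "s \<noteq> t"
      using mweights_bounds(4)[OF n _ s'(3) t'(3) 3(2), of "bs ! t"] bs t' s' by (auto simp: subset_iff)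
    then consider "t < s" | "s < t" by linarith
    then show ?thesis
    proof cases
      case 1
      then show ?thesis
        using local_confluence_adjacent[OF bs t'(3) s'(3) _ _ t(1) s(1)] 3 comm t(2) s(2) by auto
    next
      case 2
      then show ?thesis
        using local_confluence_adjacent[OF bs s'(3) t'(3) _ _ s(1) t(1)] 3 comm t(2) s(2) by auto
    qed
  qed
qed

section \<open>Termination and uniqueness of highest words\<close>

lemma height_path_e:
  assumes "set bs \<subseteq> mweights n" "path_e n i bs = Some cs"
  shows "height n cs = height n bs + 4"
  using path_e_mweights[OF n assms] height_simple_root[OF n]
  by (simp add: height_def distrib_left sum.distrib)

lemma path_height_bound: "set bs \<subseteq> mweights n \<Longrightarrow> t \<le> length bs \<Longrightarrow> path_height i bs t \<le> int t"
proof (induction t)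
  case (Suc t)
  then have "bs ! t \<in> mweights n" using nth_mem[of t bs] by auto
  then have "(bs ! t) i \<le> 1" by (rule mweights_bounds(2)[OF n])
  then show ?case using Suc by (simp add: path_height_Suc)
qed simp

lemma height_bound:
  assumes "set bs \<subseteq> mweights n"
  shows "height n bs \<le> (\<Sum>i=1..n. height_coeff n i) * int (length bs)"
  unfolding height_def sum_distrib_right
  using path_height_bound[OF assms] height_coeff_nonneg[OF n] by (intro sum_mono mult_left_mono) auto

text \<open>Raising preserves the length and adds 4 to the height, which is bounded for words of
  given length.\<close>

lemma wf_raising: "wf ((raising n J)\<inverse>)"
proof (rule wf_subset)
  let ?m = "\<lambda>bs. nat ((\<Sum>i=1..n. height_coeff n i) * int (length bs) - height n bs)"
  show "wf (measure ?m)" by simp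
  have "?m cs < ?m bs" if "(bs, cs) \<in> raising n J" for bs cs
    using that height_path_e[of bs _ cs] height_bound[of cs] path_e_mweights[OF n, of bs _ cs]
    by (auto simp: raising_def)
  then show "(raising n J)\<inverse> \<subseteq> measure ?m" by auto
qed

lemma raise_to_highest:
  assumes "set bs \<subseteq> mweights n"
  shows "\<exists>cs. (bs, cs) \<in> (raising n J)\<^sup>* \<and> highest J cs"
  using wf_raising[of J] assms
proof (induction bs rule: wf_induct_rule)
  case (less bs)
  show ?case
  proof (cases "highest J bs")
    case False
    then obtain i cs where i: "i \<in> J" "path_e n i bs = Some cs" unfolding highest_iff[of _ _ n] by auto
    then have "(bs, cs) \<in> raising n J" using less.prems by (auto simp: raising_def)
    moreover have "set cs \<subseteq> mweights n" using path_e_mweights(1)[OF n less.prems i(2)] .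
    ultimately show ?thesis using less.IH[of cs] by (meson converseI converse_rtrancl_into_rtrancl)
  qed auto
qed

lemma highest_no_raising: "highest UNIV bs \<Longrightarrow> (bs, cs) \<in> (raising n J)\<^sup>* \<Longrightarrow> cs = bs"
  by (auto simp: raising_def highest_iff[of _ _ n] elim: converse_rtranclE)

lemma unique_highest_above:
  assumes "set bs \<subseteq> mweights n" "(bs, xs) \<in> (raising n UNIV)\<^sup>*" "(bs, ys) \<in> (raising n UNIV)\<^sup>*"
    "highest UNIV xs" "highest UNIV ys"
  shows "xs = ys"
  using wf_raising[of UNIV] assms
proof (induction bs arbitrary: xs ys rule: wf_induct_rule)
  case (less bs)
  show ?case
  proof (cases "bs = xs \<or> bs = ys")
    case True
    then show ?thesis using highest_no_raising less.prems by metis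
  next
    case False
    then obtain x y where x: "(bs, x) \<in> raising n UNIV" "(x, xs) \<in> (raising n UNIV)\<^sup>*"
      and y: "(bs, y) \<in> raising n UNIV" "(y, ys) \<in> (raising n UNIV)\<^sup>*"
      using less.prems by (meson converse_rtranclE)
    have mx: "set x \<subseteq> mweights n" "set y \<subseteq> mweights n"
      using raising_mweights(1) less.prems(1) x(1) y(1) by blast+
    obtain z where z: "(x, z) \<in> (raising n UNIV)\<^sup>*" "(y, z) \<in> (raising n UNIV)\<^sup>*"
      using local_confluence x(1) y(1) by blast
    obtain zs where zs: "(z, zs) \<in> (raising n UNIV)\<^sup>*" "highest UNIV zs"
      using raise_to_highest raising_mweights(1)[OF z(1) mx(1)] by blast
    have "zs = xs" using less.IH[of x zs xs] x mx z zs less.prems by (meson converseI rtrancl_trans)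
    moreover have "zs = ys" using less.IH[of y zs ys] y mx z zs less.prems by (meson converseI rtrancl_trans)
    ultimately show ?thesis by simp
  qed
qed

lemma linked_mweights:
  assumes "linked n bs cs" "set bs \<subseteq> mweights n"
  shows "set cs \<subseteq> mweights n" "length cs = length bs"
  using assms unfolding linked_def
  by (induction) (auto simp: raising_def dest: path_e_mweights(1,2)[OF n])

text \<open>Along a zigzag ending at \<open>cs\<close>, suppose \<open>y\<close> raises to
  \<open>cs\<close> and also to its neighbour \<open>x\<close>. A highest word above
  \<open>x\<close> is then above \<open>y\<close> as well, so it equals \<open>cs\<close>.\<close>

lemma linked_highest_raising:
  assumes "linked n bs cs" "set bs \<subseteq> mweights n" "highest UNIV cs"
  shows "(bs, cs) \<in> (raising n UNIV)\<^sup>*"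
  using assms unfolding linked_def
proof (induction rule: converse_rtrancl_induct)
  case (step x y)
  have y: "set y \<subseteq> mweights n"
    using step(1,4) path_e_mweights(1)[OF n, of x _ y] by (auto simp: raising_def)
  show ?case
  proof (cases "(x, y) \<in> raising n UNIV")
    case True
    then show ?thesis using step y by (meson converse_rtrancl_into_rtrancl)
  next
    case False
    then have yx: "(y, x) \<in> (raising n UNIV)\<^sup>*" using step by auto
    obtain zs where "(x, zs) \<in> (raising n UNIV)\<^sup>*" "highest UNIV zs"
      using raise_to_highest step by blast
    then show ?thesis using unique_highest_above[OF y, of zs cs] yx step y by (metis rtrancl_trans)
  qed
qed auto

theorem linked_highest_unique:
  assumes "linked n bs cs" "set bs \<subseteq> mweights n" "highest UNIV bs" "highest UNIV cs"
  shows "cs = bs"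
  using linked_highest_raising[OF assms(1,2,4)] highest_no_raising[OF assms(3)] by blast

end

section \<open>Tensor products as path crystals\<close>

text \<open>The set is the initial segment up to \<open>d x\<close>, hence finite, so that
  \<open>Max\<close> in \<open>eps\<close> and \<open>phi\<close> is meaningful. The set
  \<open>S\<close> is there because \<open>d\<close> is controlled on elements of the crystal
  only.\<close>

lemma Max_iterate:
  assumes "\<And>x. x \<in> S \<Longrightarrow> (case f x of None \<Rightarrow> d x = 0 | Some y \<Rightarrow> y \<in> S \<and> d x = Suc (d y))" "x \<in> S"
  shows "Max {m. ((\<lambda>x. Option.bind x f) ^^ m) (Some x) \<noteq> None} = (d x :: nat)"
proof -
  have none: "((\<lambda>x. Option.bind x f) ^^ m) None = None" for m
    by (induction m) auto
  have "((\<lambda>x. Option.bind x f) ^^ m) (Some x) \<noteq> None \<longleftrightarrow> m \<le> d x" for m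
    using assms(2)
  proof (induction m arbitrary: x)
    case (Suc m)
    show ?case
      using assms(1)[OF Suc.prems] Suc.IH none
      by (cases "f x") (auto simp: funpow_Suc_right simp del: funpow.simps)
  qed simp
  then have "{m. ((\<lambda>x. Option.bind x f) ^^ m) (Some x) \<noteq> None} = {..d x}" by auto
  moreover have "Max {..d x} = d x" by (rule Max_eqI) auto
  ultimately show ?thesis by simp
qed

text \<open>An encoding of a crystal by words of one fixed length. Fixing the length makes the cut
  between concatenated words unique, so tensor products are again encoded injectively.\<close>

definition pathlike :: "nat \<Rightarrow> ('b \<Rightarrow> weight list) \<Rightarrow> nat \<Rightarrow> 'b crystal \<Rightarrow> bool" where
  "pathlike n g l B \<longleftrightarrow> closed_crystal B \<and> inj_on g (elems B) \<and>
    (\<forall>b\<in>elems B. length (g b) = l \<and> set (g b) \<subseteq> mweights n \<and> (\<forall>i. wt B b i = path_height i (g b) l) \<and>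
      (\<forall>i. map_option g (e_op B i b) = path_e n i (g b) \<and> map_option g (f_op B i b) = path_f n i (g b)))"

lemma pathlikeD:
  assumes "pathlike n g l B"
  shows "closed_crystal B" "inj_on g (elems B)"
    "b \<in> elems B \<Longrightarrow> length (g b) = l" "b \<in> elems B \<Longrightarrow> set (g b) \<subseteq> mweights n"
    "b \<in> elems B \<Longrightarrow> wt B b i = path_height i (g b) l"
    "b \<in> elems B \<Longrightarrow> map_option g (e_op B i b) = path_e n i (g b)"
    "b \<in> elems B \<Longrightarrow> map_option g (f_op B i b) = path_f n i (g b)"
  using assms by (auto simp: pathlike_def)

context
  fixes n :: nat
  assumes n: "n \<ge> 3"
begin

lemma pathlike_eps:
  assumes B: "pathlike n g l B" and b: "b \<in> elems B"
  shows "eps B i b = nat (- path_min i (g b))"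
  unfolding eps_def
proof (rule Max_iterate[where S = "elems B"])
  fix x assume x: "x \<in> elems B"
  note D = pathlikeD[OF B]
  show "case e_op B i x of None \<Rightarrow> nat (- path_min i (g x)) = 0
    | Some y \<Rightarrow> y \<in> elems B \<and> nat (- path_min i (g x)) = Suc (nat (- path_min i (g y)))"
  proof (cases "e_op B i x")
    case None
    then show ?thesis using D(6)[OF x, of i] path_e_None[of n i "g x"] by simp
  next
    case (Some y)
    then have "path_e n i (g x) = Some (g y)" using D(6)[OF x, of i] by simp
    then have "path_min i (g y) = path_min i (g x) + 1" using path_e_mweights(4)[OF n] D(4)[OF x] by blast
    then show ?thesis
      using Some closed_crystalD(1)[OF D(1) x Some] path_min_nonpos[of i "g y"] by simp
  qed
qed (rule b)

lemma pathlike_phi: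
  assumes B: "pathlike n g l B" and b: "b \<in> elems B"
  shows "phi B i b = nat (path_height i (g b) l - path_min i (g b))"
  unfolding phi_def
proof (rule Max_iterate[where S = "elems B"])
  fix x assume x: "x \<in> elems B"
  note D = pathlikeD[OF B]
  show "case f_op B i x of None \<Rightarrow> nat (path_height i (g x) l - path_min i (g x)) = 0
    | Some y \<Rightarrow> y \<in> elems B \<and> nat (path_height i (g x) l - path_min i (g x)) =
        Suc (nat (path_height i (g y) l - path_min i (g y)))"
  proof (cases "f_op B i x")
    case None
    then show ?thesis using D(7)[OF x, of i] path_f_None[of n i "g x"] D(3)[OF x] by simp
  next
    case (Some y)
    then have path_f: "path_f n i (g x) = Some (g y)" using D(7)[OF x, of i] by simp
    have y: "y \<in> elems B" using closed_crystalD(2)[OF D(1) x Some] .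
    note p = path_f_mweights[OF n D(4)[OF x] path_f]
    show ?thesis
      using Some y p(4) p(5)[of i] simple_root_self[OF p(3)] path_min_le[of l "g y" i] D(3)[OF x] D(3)[OF y]
      by simp
  qed
qed (rule b)

text \<open>Once \<open>eps\<close> and \<open>phi\<close> are read off from path minima, the tensor
  rule turns into the append rules for paths.\<close>

lemma pathlike_tensor_list:
  assumes "list_all2 (pathlike n g) ls Bs"
  shows "pathlike n (\<lambda>bs. concat (map g bs)) (sum_list ls) (tensor_list Bs)"
  using assms
proof (induction rule: list_all2_induct)
  case Nil
  have "path_e n i [] = None" "path_f n i [] = None" for i by (simp_all add: path_e_None path_f_None path_min_def)
  then show ?case by (simp add: pathlike_def closed_crystal_def)
next
  case (Cons l ls B Bs)
  let ?T = "tensor_list Bs" and ?G = "\<lambda>bs. concat (map g bs)"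
  note DB = pathlikeD[OF Cons.hyps(1)] and DT = pathlikeD[OF Cons.IH]
  have elems: "elems (tensor_list (B # Bs)) = {b # bs | b bs. b \<in> elems B \<and> bs \<in> elems ?T}"
    by (auto simp: transport_def tensor_def)
  have closed: "closed_crystal (tensor_list (B # Bs))"
  proof (rule closed_tensor_list)
    fix C assume "C \<in> set (B # Bs)"
    then show "closed_crystal C"
      using Cons.hyps by (auto simp: in_set_conv_nth list_all2_conv_all_nth dest: pathlikeD(1))
  qed
  have "length (?G x) = sum_list (l # ls) \<and> set (?G x) \<subseteq> mweights n \<and>
      (\<forall>i. wt (tensor_list (B # Bs)) x i = path_height i (?G x) (sum_list (l # ls))) \<and>
      (\<forall>i. map_option ?G (e_op (tensor_list (B # Bs)) i x) = path_e n i (?G x) \<and>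
        map_option ?G (f_op (tensor_list (B # Bs)) i x) = path_f n i (?G x))"
    if x: "x \<in> elems (tensor_list (B # Bs))" for x
  proof -
    obtain b bs where x: "x = b # bs" and b: "b \<in> elems B" and bs: "bs \<in> elems ?T"
      using x unfolding elems by blast
    note e = pathlike_eps[OF Cons.IH bs] pathlike_phi[OF Cons.hyps(1) b]
    \<comment> \<open>Both arguments of \<open>nat\<close> are nonnegative, so nothing is lost by
      truncation.\<close>
    have nat_le: "nat (- path_min i (?G bs)) \<le> nat (path_height i (g b) l - path_min i (g b)) \<longleftrightarrow>
        path_min i (g b) \<le> path_height i (g b) l + path_min i (?G bs)"
      "nat (- path_min i (?G bs)) < nat (path_height i (g b) l - path_min i (g b)) \<longleftrightarrow>
        path_min i (g b) < path_height i (g b) l + path_min i (?G bs)" for i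
      using path_min_nonpos[of i "?G bs"] path_min_le[of l "g b" i] DB(3)[OF b] by auto
    have wt: "wt (tensor_list (B # Bs)) x i = path_height i (?G x) (sum_list (l # ls))" for i
      using DB(5)[OF b, of i] DT(5)[OF bs, of i] path_height_append_total[of i "g b" "?G bs" "sum_list ls"]
      by (simp add: transport_def tensor_def x DB(3)[OF b])
    have ex: "map_option ?G (e_op (tensor_list (B # Bs)) i x) = path_e n i (?G x)" for i
    proof -
      have "map_option ?G (e_op (tensor_list (B # Bs)) i x) =
        (if path_min i (g b) \<le> path_height i (g b) l + path_min i (?G bs) then map_option (\<lambda>xs. xs @ ?G bs) (map_option g (e_op B i b))
         else map_option (\<lambda>xs. g b @ xs) (map_option ?G (e_op ?T i bs)))"
        by (simp add: transport_def tensor_def x e nat_le option.map_comp comp_def del: zless_nat_conj)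
      then show ?thesis unfolding DB(6)[OF b] DT(6)[OF bs] using DB(3)[OF b] by (simp add: x path_e_append)
    qed
    have fx: "map_option ?G (f_op (tensor_list (B # Bs)) i x) = path_f n i (?G x)" for i
    proof -
      have "map_option ?G (f_op (tensor_list (B # Bs)) i x) =
        (if path_min i (g b) < path_height i (g b) l + path_min i (?G bs) then map_option (\<lambda>xs. xs @ ?G bs) (map_option g (f_op B i b))
         else map_option (\<lambda>xs. g b @ xs) (map_option ?G (f_op ?T i bs)))"
        by (simp add: transport_def tensor_def x e nat_le option.map_comp comp_def del: zless_nat_conj)
      then show ?thesis unfolding DB(7)[OF b] DT(7)[OF bs] using DB(3)[OF b] by (simp add: x path_f_append)
    qed
    show ?thesis using wt ex fx DB(3,4)[OF b] DT(3,4)[OF bs] by (auto simp: x)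
  qed
  moreover have "inj_on ?G (elems (tensor_list (B # Bs)))"
  proof (rule inj_onI)
    fix x y
    assume xy: "x \<in> elems (tensor_list (B # Bs))" "y \<in> elems (tensor_list (B # Bs))" "?G x = ?G y"
    then obtain b bs c cs where x: "x = b # bs" "b \<in> elems B" "bs \<in> elems ?T"
      and y: "y = c # cs" "c \<in> elems B" "cs \<in> elems ?T" unfolding elems by blast
    then have "g b = g c" "?G bs = ?G cs" using xy(3) DB(3)[OF x(2)] DB(3)[OF y(2)] by auto
    then show "x = y" using x y DB(2) DT(2) by (auto dest: inj_onD)
  qed
  ultimately show ?case unfolding pathlike_def using closed by blast
qed

lemma pathlike_component:
  assumes "pathlike n g l B" "u \<in> elems B"
  shows "pathlike n g l (component B u)"
proof -
  have "elems (component B u) \<subseteq> elems B"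
    using connected_in_elems[OF _ assms(2)] by (auto simp: component_def)
  moreover have "closed_crystal (component B u)"
    using assms by (simp add: closed_component pathlikeD(1))
  moreover have "e_op (component B u) = e_op B" "f_op (component B u) = f_op B"
    "wt (component B u) = wt B"
    by (simp_all add: component_def)
  ultimately show ?thesis
    using assms(1) unfolding pathlike_def by (auto intro: inj_on_subset)
qed

lemma pathlike_minuscule:
  assumes "k \<in> {1, n - 1, n}"
  shows "pathlike n (\<lambda>\<mu>. [\<mu>]) 1 (minuscule_crystal n k)"
proof -
  have "map_option (\<lambda>\<mu>. [\<mu>]) (e_op (minuscule_crystal n k) i \<mu>) = path_e n i [\<mu>] \<and>
    map_option (\<lambda>\<mu>. [\<mu>]) (f_op (minuscule_crystal n k) i \<mu>) = path_f n i [\<mu>]"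
    if \<mu>: "\<mu> \<in> mweights n" for \<mu> i
  proof -
    note b = mweights_bounds[OF n \<mu>]
    have ht1: "path_height i [\<mu>] (Suc 0) = \<mu> i" by (simp add: path_height_Suc)
    have path_height: "t \<le> length [\<mu>] \<Longrightarrow> t = 0 \<or> t = Suc 0" for t by auto
    have path_min: "path_min i [\<mu>] = min 0 (\<mu> i)"
      by (rule path_min_eqI[where t = "if \<mu> i < 0 then 1 else 0"]) (use path_height ht1 in \<open>fastforce+\<close>)
    have e: "path_e n i [\<mu>] = (if \<mu> i = -1 then Some [\<lambda>j. \<mu> j + simple_root n i j] else None)"
    proof (cases "\<mu> i = -1")
      case True
      then have "first_min_step i [\<mu>] 0" by (simp add: first_min_step_def path_min ht1)
      from path_e_first_min_step[OF this] show ?thesis using True by (simp add: add_at_def)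
    qed (use b(1)[of i] in \<open>auto simp: path_e_None path_min\<close>)
    have f: "path_f n i [\<mu>] = (if \<mu> i = 1 then Some [\<lambda>j. \<mu> j - simple_root n i j] else None)"
    proof (cases "\<mu> i = 1")
      case True
      then have "last_min_step i [\<mu>] 0" using ht1 by (auto simp: last_min_step_def path_min le_Suc_eq)
      from path_f_last_min_step[OF this] show ?thesis using True by (simp add: add_at_def)
    qed (use b(2)[of i] ht1 in \<open>auto simp: path_f_None path_min\<close>)
    have "\<mu> i \<noteq> 0 \<Longrightarrow> i \<in> {1..n}" using b(3)[of i] by blast
    then show ?thesis unfolding e f by (auto simp: minuscule_crystal_def)
  qed
  moreover have mw: "elems (minuscule_crystal n k) \<subseteq> mweights n"
    using assms by (auto simp: minuscule_crystal_def mweights_def)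
  moreover have "wt (minuscule_crystal n k) \<mu> i = path_height i [\<mu>] 1" for \<mu> i
    by (simp add: minuscule_crystal_def path_height_Suc)
  ultimately show ?thesis
    unfolding pathlike_def using closed_minuscule by (simp add: inj_on_def subset_iff)
qed

section \<open>Connected elements and linked words\<close>

lemma pathlike_connected_linked:
  assumes B: "pathlike n g l B" and u: "u \<in> elems B" and "connected_in B u b"
  shows "linked n (g u) (g b)"
  using assms(3) unfolding connected_in_def
proof induction
  case base
  show ?case by (simp add: linked_def)
next
  case (step b c)
  have arrow: "linked n (g x) (g y)" if "(x, y) \<in> arrows B" for x y
  proof -
    from that obtain i where x: "x \<in> elems B" and y: "y \<in> elems B"
      and "e_op B i x = Some y \<or> f_op B i x = Some y" by (auto simp: arrows_def)
    then have "path_e n i (g x) = Some (g y) \<or> path_f n i (g x) = Some (g y)"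
      using pathlikeD(6,7)[OF B x, of i] by auto
    \<comment> \<open>A lowering arrow is a raising arrow read backwards.\<close>
    then have "path_e n i (g x) = Some (g y) \<or> path_e n i (g y) = Some (g x)"
      using path_f_mweights(6)[OF n] pathlikeD(4)[OF B x] by blast
    then have "(g x, g y) \<in> raising n UNIV \<union> (raising n UNIV)\<inverse>"
      using pathlikeD(4)[OF B] x y by (auto simp: raising_def)
    then show ?thesis unfolding linked_def by blast
  qed
  show ?case using step arrow linked_sym linked_trans by blast
qed

lemma pathlike_raising:
  assumes B: "pathlike n g l B" and "u \<in> elems B" "(g u, x) \<in> (raising n J)\<^sup>*"
  shows "\<exists>b\<in>elems B. g b = x"
  using assms(3)
proof induction
  case (step y z)
  then obtain b i where b: "b \<in> elems B" "g b = y" "path_e n i y = Some z" by (auto simp: raising_def)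
  then obtain c where "e_op B i b = Some c" "g c = z" using pathlikeD(6)[OF B b(1), of i] by auto
  then show ?case using closed_crystalD(1)[OF pathlikeD(1)[OF B] b(1)] by blast
qed (use assms in blast)

text \<open>The raising sequence of words lifts to arrows of the crystal, and injectivity of
  \<open>g\<close> identifies its end with \<open>u\<close>.\<close>

lemma pathlike_raising_connected:
  assumes B: "pathlike n g l B" and "u \<in> elems B" "b \<in> elems B" "(g b, g u) \<in> (raising n UNIV)\<^sup>*"
  shows "connected_in B u b"
proof -
  have "\<exists>c. c \<in> elems B \<and> g c = x \<and> (b, c) \<in> (arrows B)\<^sup>*" if "(g b, x) \<in> (raising n UNIV)\<^sup>*" for x
    using that
  proof induction
    case (step y z)
    then obtain c i where c: "c \<in> elems B" "g c = y" "(b, c) \<in> (arrows B)\<^sup>*" "path_e n i y = Some z"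
      by (auto simp: raising_def)
    then obtain d where d: "e_op B i c = Some d" "g d = z" using pathlikeD(6)[OF B c(1), of i] by auto
    moreover have "d \<in> elems B" using closed_crystalD(1)[OF pathlikeD(1)[OF B] c(1) d(1)] .
    ultimately have "(c, d) \<in> arrows B" using c(1) by (auto simp: arrows_def)
    then have "(b, d) \<in> (arrows B)\<^sup>*" using c(3) by simp
    then show ?case using d \<open>d \<in> elems B\<close> by blast
  qed (use assms in blast)
  then obtain c where "c \<in> elems B" "g c = g u" "(b, c) \<in> (arrows B)\<^sup>*" using assms(4) by blast
  then have "(b, u) \<in> (arrows B)\<^sup>*" using inj_onD[OF pathlikeD(2)[OF B]] assms(2) by blast
  then have "(u, b) \<in> ((arrows B)\<inverse>)\<^sup>*" by (rule rtrancl_converseI)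
  then show ?thesis unfolding connected_in_def by (meson in_mono rtrancl_mono sup_ge2)
qed

end

section \<open>Top components\<close>

definition top_elem :: "nat \<Rightarrow> nat \<Rightarrow> weight list" where
  "top_elem n k = (if k \<le> n - 2 then map coord_weight [1..<k + 1] else [fund_weight k])"

definition top_path :: "nat \<Rightarrow> nat list \<Rightarrow> weight list" where
  "top_path n ks = concat (map (top_elem n) ks)"

definition fund_length :: "nat \<Rightarrow> nat \<Rightarrow> nat" where
  "fund_length n k = (if k \<le> n - 2 then k else 1)"

lemma top_path_Nil [simp]: "top_path n [] = []"
  by (simp add: top_path_def)

lemma top_path_append: "top_path n (ks @ ls) = top_path n ks @ top_path n ls"
  by (simp add: top_path_def)

lemma top_path_Cons: "top_path n (k # ks) = top_elem n k @ top_path n ks"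
  by (simp add: top_path_def)

lemma length_top_elem: "length (top_elem n k) = fund_length n k"
  by (simp add: top_elem_def fund_length_def del: upt_Suc)

text \<open>The sum of the first t letters telescopes to the t-th fundamental weight, so no height
  of \<open>top_elem\<close> is negative.\<close>

lemma path_height_top_elem:
  assumes "t \<le> fund_length n k"
  shows "path_height i (top_elem n k) t =
    (if t = 0 then 0 else if k \<le> n - 2 then fund_weight t i else fund_weight k i)"
  using assms
proof (induction t)
  case (Suc t)
  then show ?case
    by (cases t) (auto simp: path_height_Suc top_elem_def fund_length_def coord_weight_def nth_append
      simp del: upt_Suc split: if_splits)
qed simp

lemma path_height_top_elem_total: "k \<ge> 1 \<Longrightarrow> path_height i (top_elem n k) (fund_length n k) = fund_weight k i"
  by (subst path_height_top_elem) (auto simp: fund_length_def)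

lemma highest_top_elem: "highest J (top_elem n k)"
  by (auto simp: highest_def length_top_elem path_height_top_elem fund_weight_def)

lemma path_height_top_path:
  "set ks \<subseteq> {1..} \<Longrightarrow> path_height i (top_path n ks) (length (top_path n ks)) = (\<Sum>k\<leftarrow>ks. fund_weight k i)"
proof (induction ks)
  case (Cons k ks)
  then show ?case
    using path_height_top_elem_total[of k i n]
    by (simp add: top_path_Cons path_height_append_total length_top_elem[symmetric])
qed simp

lemma highest_append:
  assumes "highest J bs" "highest J cs"
  shows "highest J (bs @ cs)"
  unfolding highest_def
proof (intro ballI allI impI)
  fix i t assume *: "i \<in> J" "t \<le> length (bs @ cs)"
  then have "t - length bs \<le> length cs" by auto
  moreover have "0 \<le> path_height i bs (length bs)" using assms(1) * by (simp add: highest_def)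
  ultimately show "0 \<le> path_height i (bs @ cs) t"
    using assms * by (auto simp: highest_def path_height_append)
qed

lemma highest_appendD: "highest J (bs @ cs) \<Longrightarrow> highest J bs"
  using path_height_append[of _ bs cs] unfolding highest_def by (metis length_append trans_le_add1)

lemma highest_top_path: "highest J (top_path n ks)"
proof (induction ks)
  case Nil
  show ?case by (simp add: highest_def)
next
  case (Cons k ks)
  then show ?case by (simp add: top_path_Cons highest_append highest_top_elem)
qed

lemma height_append: "height n (bs @ cs) = height n bs + height n cs"
  by (simp add: height_def path_height_append_total distrib_left sum.distrib)

lemma top_elem_in_fund_crystal: "top_elem n k \<in> elems (fund_crystal n k)"
proof (cases "k \<le> n - 2")
  case True
  then show ?thesis
    by (simp add: fund_crystal_def top_elem_def component_def connected_in_def)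
next
  case False
  then show ?thesis
    by (simp add: fund_crystal_def top_elem_def elems_tensor_list minuscule_crystal_def
        weyl_orbit.base del: tensor_list.simps)
qed

lemma elems_tensor_word: "elems (tensor_word n w) = {bs. list_all2 (\<lambda>b k. b \<in> elems (fund_crystal n k)) bs w}"
  by (simp add: tensor_word_def elems_tensor_list list_all2_map2)

lemma top_in_tensor_word: "map (top_elem n) w \<in> elems (tensor_word n w)"
  by (simp add: elems_tensor_word list_all2_conv_all_nth top_elem_in_fund_crystal)

context
  fixes n :: nat
  assumes n: "n \<ge> 3"
begin

lemma pathlike_vector_power:
  "pathlike n (\<lambda>x. x) k (tensor_list (replicate k (minuscule_crystal n 1)))"
proof -
  have "list_all2 (pathlike n (\<lambda>\<mu>. [\<mu>])) (replicate k 1) (replicate k (minuscule_crystal n 1))"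
    using pathlike_minuscule[OF n, of 1] by (simp add: list_all2_conv_all_nth)
  from pathlike_tensor_list[OF n this] show ?thesis by (simp add: sum_list_replicate)
qed

lemma coord_top_elem:
  assumes "k \<le> n - 2"
  shows "map coord_weight [1..<k + 1] \<in> elems (tensor_list (replicate k (minuscule_crystal n 1)))"
  using assms coord_weight_in_orbit[of _ n]
  by (simp add: elems_tensor_list list_all2_conv_all_nth minuscule_crystal_def del: upt_Suc)

lemma pathlike_fund_crystal:
  assumes k: "k \<in> {1..n}"
  shows "pathlike n (\<lambda>x. x) (fund_length n k) (fund_crystal n k)"
proof (cases "k \<le> n - 2")
  case True
  then show ?thesis
    using pathlike_component[OF n pathlike_vector_power coord_top_elem]
    by (simp add: fund_crystal_def fund_length_def)
next
  case False
  then have "k \<in> {1, n - 1, n}" using k by auto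
  then have "list_all2 (pathlike n (\<lambda>\<mu>. [\<mu>])) [1] [minuscule_crystal n k]"
    using pathlike_minuscule[OF n] by simp
  from pathlike_tensor_list[OF n this] show ?thesis
    using False by (simp add: fund_crystal_def fund_length_def del: tensor_list.simps)
qed

text \<open>Coordinates are -1, 0 or 1, so a simple reflection is a raising step, trivial, or a
  raising step reversed.\<close>

lemma weyl_orbit_linked:
  assumes k: "k \<in> {1, n - 1, n}" and "\<mu> \<in> weyl_orbit n (fund_weight k)"
  shows "linked n [fund_weight k] [\<mu>]"
  using assms(2)
proof induction
  case base
  show ?case by (simp add: linked_def)
next
  case (refl \<mu> i)
  have up: "linked n [\<nu>] [simple_refl n i \<nu>]" if "\<nu> \<in> weyl_orbit n (fund_weight k)" "\<nu> i = -1" for \<nu>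
  proof -
    have \<nu>: "\<nu> \<in> elems (minuscule_crystal n k)" using that by (simp add: minuscule_crystal_def)
    have "simple_refl n i \<nu> = (\<lambda>j. \<nu> j + simple_root n i j)" using that by (simp add: simple_refl_def)
    then have "path_e n i [\<nu>] = Some [simple_refl n i \<nu>]"
      using pathlikeD(6)[OF pathlike_minuscule[OF n k] \<nu>, of i] that refl.hyps(2)
      by (simp add: minuscule_crystal_def)
    moreover have "\<nu> \<in> mweights n" using that(1) k by (auto simp: mweights_def)
    ultimately have "([\<nu>], [simple_refl n i \<nu>]) \<in> raising n UNIV" by (auto simp: raising_def)
    then show ?thesis using raising_linked by blast
  qed
  have "\<mu> \<in> mweights n" using refl.hyps(1) k by (auto simp: mweights_def)
  then consider "\<mu> i = -1" | "\<mu> i = 0" | "\<mu> i = 1"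
    using mweights_bounds(1,2)[OF n, of \<mu> i] by linarith
  then show ?case
  proof cases
    case 1
    then show ?thesis using refl up linked_trans by blast
  next
    case 2
    then have "simple_refl n i \<mu> = \<mu>" by (simp add: simple_refl_def)
    then show ?thesis using refl by simp
  next
    case 3
    have "simple_refl n i \<mu> i = -1" "simple_refl n i (simple_refl n i \<mu>) = \<mu>"
      using 3 simple_root_self[OF refl.hyps(2)] by (auto simp: simple_refl_def)
    then have "linked n [simple_refl n i \<mu>] [\<mu>]"
      using up[of "simple_refl n i \<mu>"] weyl_orbit.refl[OF refl.hyps] by simp
    then show ?thesis using refl.IH linked_sym linked_trans by blast
  qed
qed

lemma fund_crystal_linked:
  assumes k: "k \<in> {1..n}" and b: "b \<in> elems (fund_crystal n k)"
  shows "linked n (top_elem n k) b"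
proof (cases "k \<le> n - 2")
  case True
  then show ?thesis
    using b pathlike_connected_linked[OF n pathlike_vector_power coord_top_elem[OF True], of b]
    by (simp add: fund_crystal_def top_elem_def component_def)
next
  case False
  then have "k \<in> {1, n - 1, n}" using k by auto
  moreover obtain \<mu> where "b = [\<mu>]" "\<mu> \<in> weyl_orbit n (fund_weight k)"
    using b False by (auto simp: fund_crystal_def elems_tensor_list minuscule_crystal_def list_all2_Cons2
        simp del: tensor_list.simps)
  ultimately show ?thesis using weyl_orbit_linked False by (simp add: top_elem_def)
qed

lemma top_elem_mweights: "k \<in> {1..n} \<Longrightarrow> set (top_elem n k) \<subseteq> mweights n"
  using pathlikeD(4)[OF pathlike_fund_crystal top_elem_in_fund_crystal] by blast

lemma top_path_mweights:
  assumes "set ks \<subseteq> {1..n}"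
  shows "set (top_path n ks) \<subseteq> mweights n"
proof -
  have "set (top_elem n k) \<subseteq> mweights n" if "k \<in> set ks" for k
    using that assms top_elem_mweights by blast
  then show ?thesis by (auto simp: top_path_def)
qed

section \<open>The top element as the unique element of maximal height\<close>

lemma raising_height:
  assumes "(bs, cs) \<in> (raising n J)\<^sup>*"
  shows "height n bs \<le> height n cs" "height n bs = height n cs \<Longrightarrow> bs = cs"
proof -
  have "bs = cs \<or> height n bs < height n cs"
    using assms
  proof induction
    case (step y z)
    then have "height n z = height n y + 4" using height_path_e[OF n] by (auto simp: raising_def)
    then show ?case using step.IH by auto
  qed simp
  then show "height n bs \<le> height n cs" "height n bs = height n cs \<Longrightarrow> bs = cs" by auto
qed

lemma fund_crystal_height:
  assumes k: "k \<in> {1..n}" and b: "b \<in> elems (fund_crystal n k)"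
  shows "height n b \<le> height n (top_elem n k)" "height n b = height n (top_elem n k) \<Longrightarrow> b = top_elem n k"
proof -
  have "set b \<subseteq> mweights n" using pathlikeD(4)[OF pathlike_fund_crystal[OF k] b] .
  then have "(b, top_elem n k) \<in> (raising n UNIV)\<^sup>*"
    using linked_highest_raising[OF n linked_sym[OF fund_crystal_linked[OF k b]]] highest_top_elem by blast
  from raising_height[OF this] show "height n b \<le> height n (top_elem n k)"
    "height n b = height n (top_elem n k) \<Longrightarrow> b = top_elem n k" by auto
qed

lemma pathlike_tensor_word:
  assumes "set w \<subseteq> {1..n}"
  shows "pathlike n concat (\<Sum>k\<leftarrow>w. fund_length n k) (tensor_word n w)"
proof -
  have "list_all2 (pathlike n (\<lambda>x. x)) (map (fund_length n) w) (map (fund_crystal n) w)"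
    using assms pathlike_fund_crystal nth_mem by (fastforce simp: list_all2_conv_all_nth subset_iff)
  from pathlike_tensor_list[OF n this] show ?thesis by (simp add: tensor_word_def)
qed

text \<open>Heights add up over the factors, so equality in the bound forces equality in every
  factor.\<close>

lemma tensor_word_height:
  assumes "list_all2 (\<lambda>b k. b \<in> elems (fund_crystal n k)) bs w" "set w \<subseteq> {1..n}"
  shows "height n (concat bs) \<le> height n (top_path n w) \<and>
    (height n (concat bs) = height n (top_path n w) \<longrightarrow> bs = map (top_elem n) w)"
  using assms
proof (induction rule: list_all2_induct)
  case (Cons b bs k w)
  then show ?case
    using fund_crystal_height[of k b] by (auto simp: height_append top_path_Cons)
qed simp

lemma length_concat_tensor_word:
  assumes "set w \<subseteq> {1..n}" "bs \<in> elems (tensor_word n w)"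
  shows "length (concat bs) = (\<Sum>k\<leftarrow>w. fund_length n k)"
  using pathlikeD(3)[OF pathlike_tensor_word[OF assms(1)] assms(2)] .

text \<open>A highest weight element of the prescribed weight has maximal height and is therefore
  the product of the top elements. From here on \<open>linked\<close> takes the place of
  connectedness.\<close>

lemma top_component_iff:
  assumes w: "set w \<subseteq> {1..n}"
  shows "b \<in> top_component n w \<longleftrightarrow> b \<in> elems (tensor_word n w) \<and> linked n (top_path n w) (concat b)"
proof
  let ?W = "tensor_word n w"
  note W = pathlike_tensor_word[OF w]
  have w1: "set w \<subseteq> {1..}" using w by auto
  have len: "length (top_path n w) = (\<Sum>k\<leftarrow>w. fund_length n k)"
    using length_concat_tensor_word[OF w top_in_tensor_word] by (simp add: top_path_def)
  {
    assume "b \<in> top_component n w"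
    then obtain u where u: "u \<in> elems ?W" "wt ?W u = (\<lambda>i. \<Sum>k\<leftarrow>w. fund_weight k i)" "connected_in ?W u b"
      by (auto simp: top_component_def highest_weight_elem_def)
    have "path_height i (concat u) (length (concat u)) = path_height i (top_path n w) (length (top_path n w))" for i
      using fun_cong[OF u(2), of i] pathlikeD(5)[OF W u(1), of i] path_height_top_path[OF w1]
        length_concat_tensor_word[OF w u(1)] by simp
    then have "height n (concat u) = height n (top_path n w)" by (simp add: height_def)
    then have "u = map (top_elem n) w"
      using tensor_word_height[OF _ w] u(1) by (simp add: elems_tensor_word)
    then show "b \<in> elems ?W \<and> linked n (top_path n w) (concat b)"
      using pathlike_connected_linked[OF n W u(1,3)] connected_in_elems[OF u(3,1)] by (simp add: top_path_def)
  next
    assume b: "b \<in> elems ?W \<and> linked n (top_path n w) (concat b)"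
    let ?u = "map (top_elem n) w"
    have u: "?u \<in> elems ?W" by (rule top_in_tensor_word)
    have cu: "concat ?u = top_path n w" by (simp add: top_path_def)
    have "wt ?W ?u = (\<lambda>i. \<Sum>k\<leftarrow>w. fund_weight k i)"
      using pathlikeD(5)[OF W u] path_height_top_path[OF w1, of _ n, unfolded len] by (simp add: cu fun_eq_iff)
    moreover have "e_op ?W i ?u = None" for i
      using pathlikeD(6)[OF W u, of i] highest_top_path[of UNIV n w] by (simp add: cu highest_iff[of _ _ n])
    ultimately have "highest_weight_elem ?W (\<lambda>i. \<Sum>k\<leftarrow>w. fund_weight k i) ?u"
      using u by (simp add: highest_weight_elem_def)
    moreover have "(concat b, concat ?u) \<in> (raising n UNIV)\<^sup>*"
      unfolding cu using b linked_highest_raising[OF n linked_sym _ highest_top_path] pathlikeD(4)[OF W] by blast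
    then have "connected_in ?W ?u b" using pathlike_raising_connected[OF n W u] b by blast
    ultimately show "b \<in> top_component n w" unfolding top_component_def by blast
  }
qed

end

section \<open>Adjacent pairs\<close>

text \<open>Two situations in which a pair condition pins down the next letter, with labels
  \<open>ls\<close>; \<open>ps\<close> collects all labels up to and including the current letter
  \<open>ks\<close>. In the first, the next top word has weight zero at all colours killed by
  \<open>ks\<close>. In the second, deleting node k cuts the diagram between lower and upper
  colours.\<close>

definition separated :: "nat \<Rightarrow> nat list \<Rightarrow> nat list \<Rightarrow> nat list \<Rightarrow> bool" where
  "separated n ps ks ls \<longleftrightarrow> set ls \<subseteq> set ks \<or>
    (\<exists>k. ks = [k] \<and> k \<le> n - 2 \<and> set ps \<subseteq> {..k} \<and> set ls \<subseteq> {k..})"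

text \<open>Every adjacent pair of letters lies in its top component, expressed through
  \<open>linked\<close> so that the condition can be carried along a component.\<close>

definition chained :: "nat \<Rightarrow> letter list \<Rightarrow> weight list list \<Rightarrow> bool" where
  "chained n w b \<longleftrightarrow> (\<forall>i<length w - 1.
    linked n (top_path n (word_labels n [w ! i, w ! (i + 1)]))
      (concat (take (length (word_labels n [w ! i, w ! (i + 1)]))
        (drop (length (word_labels n (take i w))) b))))"

lemma fund_weight_sum: "(\<Sum>k\<leftarrow>ks. fund_weight k i) = int (count_list ks i)"
  by (induction ks) (auto simp: fund_weight_def)

lemma word_labels_append: "word_labels n (v @ w) = word_labels n v @ word_labels n w"
  by (simp add: word_labels_def)

lemma word_labels_pair:
  assumes "i < length w - 1"
  shows "word_labels n w = word_labels n (take i w) @ word_labels n [w ! i, w ! (i + 1)] @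
    word_labels n (drop (i + 2) w)"
proof -
  have "w = take i w @ [w ! i, w ! (i + 1)] @ drop (i + 2) w"
    using assms by (simp add: Cons_nth_drop_Suc)
  then show ?thesis by (metis word_labels_append)
qed

section \<open>Tensor products and compositions of projections\<close>

lemma tensor_map_proj_on:
  "tensor_map k (proj_on A) (proj_on B) = proj_on {b. take k b \<in> A \<and> drop k b \<in> B}"
  by (auto simp: tensor_map_def proj_on_def fun_eq_iff split: Option.bind_splits if_splits)

lemma proj_on_comp: "proj_on A \<circ> proj_on B = proj_on (A \<inter> B)"
  by (auto simp: proj_on_def fun_eq_iff split: Option.bind_splits if_splits)

lemma foldr_proj_on:
  "foldr (\<circ>) (map (\<lambda>i. proj_on (S i)) js) (proj_on E) = proj_on (E \<inter> (\<Inter>i\<in>set js. S i))"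
proof (induction js)
  case (Cons i js)
  have "foldr (\<circ>) (map (\<lambda>i. proj_on (S i)) (i # js)) (proj_on E) =
      proj_on (S i \<inter> (E \<inter> (\<Inter>i\<in>set js. S i)))"
    by (simp only: list.map foldr.simps comp_apply[of "(\<circ>) _"] Cons.IH proj_on_comp)
  also have "S i \<inter> (E \<inter> (\<Inter>i\<in>set js. S i)) = E \<inter> (\<Inter>i\<in>set (i # js). S i)" by auto
  finally show ?case .
qed simp

lemma chained_top: "chained n w (map (top_elem n) (word_labels n w))"
  unfolding chained_def
proof (intro allI impI)
  fix i assume i: "i < length w - 1"
  show "linked n (top_path n (word_labels n [w ! i, w ! (i + 1)]))
    (concat (take (length (word_labels n [w ! i, w ! (i + 1)]))
      (drop (length (word_labels n (take i w))) (map (top_elem n) (word_labels n w)))))"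
    unfolding word_labels_pair[OF i] by (simp add: top_path_def linked_def)
qed

context
  fixes n :: nat
  assumes n: "n \<ge> 3"
begin

text \<open>By the tensor rule each operator acts in one of the two halves, so a walk of the whole
  word induces a walk of each half.\<close>

lemma linked_append:
  assumes "linked n (xs @ xs') zs" "set (xs @ xs') \<subseteq> mweights n"
  shows "linked n xs (take (length xs) zs) \<and> linked n xs' (drop (length xs) zs)"
  using assms(1) unfolding linked_def[of n "xs @ xs'"]
proof induction
  case base
  show ?case by (simp add: linked_def)
next
  case (step y z)
  let ?k = "length xs"
  have one: "linked n (take ?k a) (take ?k b) \<and> linked n (drop ?k a) (drop ?k b)"
    if ab: "(a, b) \<in> raising n UNIV" "?k \<le> length a" for a b
  proof -
    obtain i where a: "set a \<subseteq> mweights n" and i: "path_e n i a = Some b" using ab by (auto simp: raising_def)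
    have parts: "set (take ?k a) \<subseteq> mweights n" "set (drop ?k a) \<subseteq> mweights n"
      using a by (meson order_trans set_take_subset set_drop_subset)+
    have "path_e n i (take ?k a @ drop ?k a) = Some b" using i by simp
    then consider c where "path_e n i (take ?k a) = Some c" "b = c @ drop ?k a"
      | c where "path_e n i (drop ?k a) = Some c" "b = take ?k a @ c"
      unfolding path_e_append by (auto split: if_splits)
    then show ?thesis
    proof cases
      case 1
      then have "(take ?k a, c) \<in> raising n UNIV" using parts by (auto simp: raising_def)
      then have "linked n (take ?k a) c" using raising_linked by blast
      moreover have "length c = ?k" using path_e_mweights(2)[OF n parts(1) 1(1)] ab(2) by simp
      ultimately show ?thesis using 1 by (simp add: linked_def)
    next
      case 2
      then have "(drop ?k a, c) \<in> raising n UNIV" using parts by (auto simp: raising_def)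
      then have "linked n (drop ?k a) c" using raising_linked by blast
      then show ?thesis using 2 ab(2) by (simp add: linked_def)
    qed
  qed
  have "linked n (xs @ xs') y" "linked n (xs @ xs') z"
    using step.hyps(1) rtrancl.rtrancl_into_rtrancl[OF step.hyps(1,2)] unfolding linked_def by auto
  then have "?k \<le> length y" "?k \<le> length z"
    using linked_mweights(2)[OF n _ assms(2)] by fastforce+
  then have "linked n (take ?k y) (take ?k z) \<and> linked n (drop ?k y) (drop ?k z)"
    using one step.hyps(2) linked_sym by blast
  then show ?case using step.IH linked_trans by blast
qed

text \<open>At colours in \<open>J\<close> the word \<open>xs\<close> has minimum and total zero, so
  a negative minimum of the second part lies strictly lower and the operator acts there.\<close>

lemma raising_append:
  assumes "(c, d) \<in> (raising n J)\<^sup>*" "set (xs @ c) \<subseteq> mweights n" "highest J xs"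
    "\<And>i. i \<in> J \<Longrightarrow> path_height i xs (length xs) = 0"
  shows "(xs @ c, xs @ d) \<in> (raising n J)\<^sup>*"
  using assms(1)
proof induction
  case (step y z)
  then obtain i where i: "i \<in> J" "path_e n i y = Some z" "set y \<subseteq> mweights n" by (auto simp: raising_def)
  have "path_min i xs = 0" using assms(3) i(1) unfolding highest_iff[of _ _ n] path_e_None by blast
  moreover have "path_min i y < 0" using i(2) path_e_None[of n i y] path_min_nonpos[of i y] by fastforce
  ultimately have "path_e n i (xs @ y) = Some (xs @ z)" using i assms(4)[OF i(1)] by (simp add: path_e_append)
  then have "(xs @ y, xs @ z) \<in> raising n J" using i assms(2) by (auto simp: raising_def)
  then show ?case using step.IH by simp
qed simp

text \<open>Raising \<open>c\<close> along the colours \<open>J\<close> annihilated by the weight of \<open>xs\<close> keeps \<open>xs\<close> fixed. As the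
  letters are minuscule and that weight is at least one at the other colours, all prefixes of the
  result are of highest weight, and they are determined one letter at a time.\<close>

lemma linked_append_raising:
  assumes xs: "set xs \<subseteq> mweights n" and c0: "set c0 \<subseteq> mweights n"
    and hxs: "highest UNIV xs" and hc0: "highest UNIV c0" and link: "linked n (xs @ c0) (xs @ c)"
  defines "J \<equiv> {i. path_height i xs (length xs) = 0}"
  shows "(c, c0) \<in> (raising n J)\<^sup>*"
proof -
  have xc0: "set (xs @ c0) \<subseteq> mweights n" using xs c0 by simp
  have xc: "set (xs @ c) \<subseteq> mweights n" "length c = length c0"
    using linked_mweights[OF n link xc0] by auto
  then obtain d where d: "(c, d) \<in> (raising n J)\<^sup>*" "highest J d"
    using raise_to_highest[OF n, of c J] by auto
  have "(xs @ c, xs @ d) \<in> (raising n J)\<^sup>*"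
    by (rule raising_append[OF d(1) xc(1)]) (use hxs in \<open>auto simp: J_def highest_def\<close>)
  then have link': "linked n (xs @ c0) (xs @ d)" using link raising_linked linked_trans by blast
  have len: "length d = length c0" using linked_mweights(2)[OF n link' xc0] by simp
  have md: "set d \<subseteq> mweights n" using linked_mweights(1)[OF n link' xc0] by simp
  have "take q d = take q c0" if "q \<le> length c0" for q
    using that
  proof (induction q)
    case (Suc q)
    then have q: "q < length c0" "q < length d" and IH: "take q d = take q c0" using len by auto
    have hq: "0 \<le> path_height i c0 q" for i using hc0 q by (simp add: highest_def)
    have same: "path_height i d u = path_height i c0 u" if "u \<le> q" for i u
    proof -
      have "path_height i (take q d @ drop q d) u = path_height i (take q c0 @ drop q c0) u"
        using that q unfolding path_height_append IH by simp
      then show ?thesis by simp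
    qed
    have step: "-1 \<le> (d ! q) i" for i using mweights_bounds(1)[OF n] md nth_mem[OF q(2)] by blast
    have tot: "0 \<le> path_height i xs (length xs)" for i using hxs by (simp add: highest_def)
    have "0 \<le> path_height i (xs @ take (Suc q) d) t" if t: "t \<le> length (xs @ take (Suc q) d)" for i t
    proof (cases "t \<le> length xs")
      case True
      then show ?thesis using hxs by (simp add: path_height_append highest_def)
    next
      case False
      define u where "u = t - length xs"
      have u: "u \<le> Suc q" using t q u_def by simp
      have "path_height i (take (Suc q) d) u = path_height i (take (Suc q) d @ drop (Suc q) d) u"
        using u q unfolding path_height_append by simp
      then have eq: "path_height i (xs @ take (Suc q) d) t = path_height i xs (length xs) + path_height i d u"
        using False by (simp add: path_height_append u_def)
      consider "u \<le> q" | "u = Suc q" "i \<in> J" | "u = Suc q" "i \<notin> J" using u by linarith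
      then show ?thesis
      proof cases
        case 1
        then show ?thesis using eq same hc0 tot q by (simp add: highest_def)
      next
        case 2
        then have "0 \<le> path_height i d u" using d(2) q by (simp add: highest_def)
        then show ?thesis using eq tot[of i] by simp
      next
        case 3
        then have "1 \<le> path_height i xs (length xs)" using tot[of i] by (simp add: J_def)
        then show ?thesis using eq 3 step[of i] hq[of i] same[of q i] by (simp add: path_height_Suc)
      qed
    qed
    then have h: "highest UNIV (xs @ take (Suc q) d)" by (simp add: highest_def)
    have h0: "highest UNIV (xs @ take (Suc q) c0)"
      using highest_append[OF hxs highest_appendD[of UNIV "take (Suc q) c0" "drop (Suc q) c0"]] hc0 by simp
    have "linked n ((xs @ take (Suc q) c0) @ drop (Suc q) c0) (xs @ d)" using link' by simp
    from linked_append[OF this] have "linked n (xs @ take (Suc q) c0) (xs @ take (Suc q) d)"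
      using xc0 q by simp
    moreover have "set (xs @ take (Suc q) c0) \<subseteq> mweights n"
      using xc0 set_take_subset[of "Suc q" c0] by auto
    ultimately show ?case using linked_highest_unique[OF n] h h0 by blast
  qed simp
  from this[of "length c0"] have "d = c0" using len by simp
  then show ?thesis using d(1) by simp
qed

text \<open>Seen from \<open>c0\<close>, lowering along \<open>J2\<close> never makes lowering along \<open>J1\<close> possible, so \<open>c\<close> is reached
  along \<open>J2\<close> only.\<close>

lemma raising_disconnected:
  assumes "(c, c0) \<in> (raising n (J1 \<union> J2))\<^sup>*" "set c0 \<subseteq> mweights n" "highest UNIV c0"
    and tot: "\<And>i. i \<in> J1 \<Longrightarrow> path_height i c0 (length c0) = 0"
    and J: "\<And>i j. i \<in> J1 \<Longrightarrow> j \<in> J2 \<Longrightarrow> simple_root n j i = 0"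
    and c: "highest J2 c"
  shows "c = c0"
proof -
  have "highest J1 c \<and> (\<forall>i\<in>J1. path_height i c (length c) = 0) \<and> (highest J2 c \<longrightarrow> c = c0)"
    using assms(1)
  proof (induction rule: converse_rtrancl_induct)
    case base
    then show ?case using assms(3) tot by (auto simp: highest_def)
  next
    case (step y z)
    then obtain j where y: "set y \<subseteq> mweights n" and j: "j \<in> J1 \<union> J2" "path_e n j y = Some z"
      by (auto simp: raising_def)
    note p = path_e_mweights[OF n y j(2)]
    \<comment> \<open>Otherwise \<open>z\<close> has minimum and total zero at j, so
      \<open>y\<close> has minimum -1 and total -2; but a minimum cannot exceed the total.\<close>
    have "j \<notin> J1"
    proof
      assume "j \<in> J1"
      then have "path_min j z = 0" "path_height j z (length z) = 0"
        using step.IH unfolding highest_iff[of _ _ n] path_e_None by auto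
      then show False
        using p(4) p(5)[of j] simple_root_self[OF p(3)] path_min_le[of "length y" y j] by simp
    qed
    then have j2: "j \<in> J2" using j by simp
    obtain t where t: "first_min_step j y t" "z = add_at t (simple_root n j) y" using j(2) by (rule path_e_SomeE)
    have "path_height i z u = path_height i y u" if "i \<in> J1" for i u
      using t first_min_step_step(4)[OF n y t(1)] J[OF that j2] by (simp add: path_height_add_at)
    then have "highest J1 y \<and> (\<forall>i\<in>J1. path_height i y (length y) = 0)"
      using step.IH p(2) by (simp add: highest_def)
    moreover have "\<not> highest J2 y" using j2 j(2) unfolding highest_iff[of _ _ n] by auto
    ultimately show ?case by blast
  qed
  then show ?thesis using c by blast
qed

text \<open>The colours killed by the current letter split into \<open>J1\<close>, where the next
  top word has weight zero, and \<open>J2\<close>, where \<open>c\<close> is already highest because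
  no label so far belongs to \<open>J2\<close>. No node of \<open>J1\<close> is joined to one of
  \<open>J2\<close>.\<close>

lemma separated_step:
  assumes ps: "set ps \<subseteq> {1..n}" and ks: "set ks \<subseteq> {1..n}" and ls: "set ls \<subseteq> {1..n}"
    and sep: "separated n (ps @ ks) ks ls"
    and link: "linked n (top_path n ks @ top_path n ls) (top_path n ks @ c)"
    and h: "highest UNIV (top_path n (ps @ ks) @ c)"
  shows "c = top_path n ls"
proof -
  have pos: "set (ps @ ks) \<subseteq> {1..}" "set ks \<subseteq> {1..}" "set ls \<subseteq> {1..}" using ps ks ls by auto
  let ?J = "{i. path_height i (top_path n ks) (length (top_path n ks)) = 0}"
  have J: "?J = - set ks"
    by (auto simp: path_height_top_path[OF pos(2)] fund_weight_sum count_list_0_iff)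
  have totls: "path_height i (top_path n ls) (length (top_path n ls)) = 0" if "i \<notin> set ls" for i
    using that by (simp add: path_height_top_path[OF pos(3)] fund_weight_sum count_list_0_iff)
  have hc: "highest (- set (ps @ ks)) c"
    unfolding highest_def
  proof (intro ballI allI impI)
    fix i t assume i: "i \<in> - set (ps @ ks)" and t: "t \<le> length c"
    have "path_height i (top_path n (ps @ ks)) (length (top_path n (ps @ ks))) = 0"
      using i by (auto simp: path_height_top_path[OF pos(1)] fund_weight_sum count_notin)
    then have "path_height i (top_path n (ps @ ks) @ c) (length (top_path n (ps @ ks)) + t) = path_height i c t"
      by (simp add: path_height_append_total)
    moreover have "0 \<le> path_height i (top_path n (ps @ ks) @ c) (length (top_path n (ps @ ks)) + t)"
      using h t by (simp add: highest_def)
    ultimately show "0 \<le> path_height i c t" by simp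
  qed
  obtain J1 J2 where J12: "- set ks = J1 \<union> J2" "J1 \<inter> set ls = {}" "J2 \<subseteq> - set (ps @ ks)"
    "\<And>i j. i \<in> J1 \<Longrightarrow> j \<in> J2 \<Longrightarrow> simple_root n j i = 0"
  proof (cases "set ls \<subseteq> set ks")
    case True
    then show ?thesis using that[of "- set ks" "{}"] by blast
  next
    case False
    then obtain k where k: "ks = [k]" "k \<le> n - 2" "set (ps @ ks) \<subseteq> {..k}" "set ls \<subseteq> {k..}"
      using sep by (auto simp: separated_def)
    \<comment> \<open>As k \<le> n - 2, deleting node k disconnects the colours below it from those
      above, both spin nodes included. Indices beyond n carry no root and join \<open>?J1\<close> to
      exhaust the complement.\<close>
    let ?J1 = "{i. i < k \<or> n < i}" and ?J2 = "{k<..n}"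
    have "simple_root n j i = 0" if "i \<in> ?J1" "j \<in> ?J2" for i j
      using that k(2) n by (auto simp: simple_root_def cartan_D_def adjacent_D_def)
    moreover have "- set ks = ?J1 \<union> ?J2" using k(1,2) n by auto
    moreover have "?J1 \<inter> set ls = {}" using k(4) ls by fastforce
    moreover have "?J2 \<subseteq> - set (ps @ ks)" using k(3) by fastforce
    ultimately show ?thesis using that by blast
  qed
  have "(c, top_path n ls) \<in> (raising n (J1 \<union> J2))\<^sup>*"
    using linked_append_raising[OF _ _ highest_top_path highest_top_path link]
      top_path_mweights[OF n ks] top_path_mweights[OF n ls] unfolding J J12(1) by blast
  then show ?thesis
    by (rule raising_disconnected[OF _ top_path_mweights[OF n ls] highest_top_path])
      (use totls J12 hc in \<open>auto simp: highest_def\<close>)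
qed

section \<open>Pair conditions along components\<close>

lemma linked_pieces:
  assumes ks: "set ks \<subseteq> {1..n}" and b: "b \<in> elems (tensor_word n ks)" and c: "c \<in> elems (tensor_word n ks)"
    and link: "linked n (concat b) (concat c)"
  shows "linked n (concat (take k b)) (concat (take k c)) \<and> linked n (concat (drop k b)) (concat (drop k c))"
proof -
  have ks': "set (take k ks) \<subseteq> {1..n}" using ks set_take_subset by fast
  have "take k b \<in> elems (tensor_word n (take k ks))" "take k c \<in> elems (tensor_word n (take k ks))"
    using b c by (auto simp: elems_tensor_word list_all2_takeI)
  \<comment> \<open>Labels determine lengths, so both flattened words are cut at the same
    position.\<close>
  then have len: "length (concat (take k b)) = length (concat (take k c))"
    using length_concat_tensor_word[OF n ks'] by simp
  have split: "concat xs = concat (take k xs) @ concat (drop k xs)" for xs :: "weight list list"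
    by (metis append_take_drop_id concat_append)
  have "set (concat b) \<subseteq> mweights n" using pathlikeD(4)[OF pathlike_tensor_word[OF n ks] b] .
  from linked_append[of "concat (take k b)" "concat (drop k b)" "concat c"] link this
  show ?thesis by (simp add: len split[of b, symmetric]) (simp add: split[of c])
qed

lemma linked_middle:
  assumes ks: "set ks \<subseteq> {1..n}" and b: "b \<in> elems (tensor_word n ks)" and c: "c \<in> elems (tensor_word n ks)"
    and link: "linked n (concat b) (concat c)"
  shows "linked n (concat (take m (drop k b))) (concat (take m (drop k c)))"
proof -
  have "set (drop k ks) \<subseteq> {1..n}" using ks set_drop_subset by fast
  moreover have "drop k b \<in> elems (tensor_word n (drop k ks))" "drop k c \<in> elems (tensor_word n (drop k ks))"
    using b c by (auto simp: elems_tensor_word list_all2_dropI)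
  ultimately show ?thesis using linked_pieces linked_pieces[OF assms] by blast
qed

lemma chained_linked:
  assumes w: "set (word_labels n w) \<subseteq> {1..n}"
    and b: "b \<in> elems (tensor_word n (word_labels n w))" and c: "c \<in> elems (tensor_word n (word_labels n w))"
    and "linked n (concat b) (concat c)" "chained n w b"
  shows "chained n w c"
  using assms linked_middle[OF w b c] linked_trans unfolding chained_def by blast

text \<open>Prefixes are identified one letter at a time: each pair condition supplies the link that
  \<open>separated_step\<close> consumes.\<close>

lemma chained_highest:
  assumes w: "set (word_labels n w) \<subseteq> {1..n}" and ne: "w \<notin> {[X], [Y], [Z]}"
    and sep: "\<And>i. i < length w - 1 \<Longrightarrow>
      separated n (word_labels n (take (Suc i) w)) (letter_labels n (w ! i)) (letter_labels n (w ! (i + 1)))"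
    and b: "b \<in> elems (tensor_word n (word_labels n w))" and ch: "chained n w b"
    and h: "highest UNIV (concat b)"
  shows "concat b = top_path n (word_labels n w)"
proof -
  let ?l = "\<lambda>p. length (word_labels n (take p w))"
  have lb: "length b = length (word_labels n w)"
    using b by (auto simp: elems_tensor_word list_all2_lengthD)
  have "concat (take (?l p) b) = top_path n (word_labels n (take p w))" if "p \<le> length w" for p
    using that
  proof (induction p)
    case 0
    show ?case by (simp add: word_labels_def)
  next
    case (Suc p)
    let ?ls = "letter_labels n (w ! p)"
    have p: "p < length w" using Suc by simp
    have wp: "word_labels n (take (Suc p) w) = word_labels n (take p w) @ ?ls"
      using p by (simp add: take_Suc_conv_app_nth word_labels_def)
    have sub: "set (word_labels n (take (Suc p) w)) \<subseteq> {1..n}"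
      using w word_labels_append[of n "take (Suc p) w" "drop (Suc p) w"] by simp
    then have ls: "set ?ls \<subseteq> {1..n}" and ps: "set (word_labels n (take p w)) \<subseteq> {1..n}" by (auto simp: wp)
    have IH: "concat (take (?l p) b) = top_path n (word_labels n (take p w))" using Suc by simp
    define c where "c = take (length ?ls) (drop (?l p) b)"
    have cc: "concat (take (?l (Suc p)) b) = top_path n (word_labels n (take p w)) @ concat c"
      unfolding wp by (simp add: take_add IH c_def)
    have hc: "highest UNIV (top_path n (word_labels n (take p w)) @ concat c)"
      unfolding cc[symmetric]
      using h highest_appendD[of UNIV "concat (take (?l (Suc p)) b)" "concat (drop (?l (Suc p)) b)"]
      by (metis append_take_drop_id concat_append)
    have "concat c = top_path n ?ls"
    proof (cases p)
      case 0
      then have pw: "word_labels n (take p w) = []" by (simp add: word_labels_def)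
      have hc: "highest UNIV (concat c)" using hc by (simp add: pw)
      \<comment> \<open>A one-letter word is here a single fundamental crystal, which is connected;
        in longer words the first letter inherits its link from the first pair.\<close>
      have "linked n (top_path n ?ls) (concat c)"
      proof (cases "length w = 1")
        case True
        then obtain k where k: "w = [Fund k]"
          using ne by (cases w; cases "hd w") auto
        then have lk: "?ls = [k]" "word_labels n w = [k]" using 0 by (auto simp: word_labels_def)
        then obtain b0 where "b = [b0]" "b0 \<in> elems (fund_crystal n k)"
          using b by (auto simp: elems_tensor_word list_all2_Cons2)
        then show ?thesis
          using fund_crystal_linked[OF n, of k b0] w lk by (simp add: c_def pw top_path_def)
      next
        case False
        then have i: "0 < length w - 1" using p by simp
        let ?ls' = "letter_labels n (w ! 1)"
        have "linked n (top_path n ?ls @ top_path n ?ls') (concat (take (length ?ls + length ?ls') b))"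
          using ch[unfolded chained_def, rule_format, OF i] 0
          by (simp add: word_labels_def top_path_append)
        moreover have "set (word_labels n (take 2 w)) \<subseteq> {1..n}"
          using w word_labels_append[of n "take 2 w" "drop 2 w"] by simp
        then have ls': "set ?ls' \<subseteq> {1..n}"
          using i by (cases w; cases "tl w") (auto simp: word_labels_def)
        have "length (concat c) = length (top_path n ?ls)"
        proof -
          have "take (length ?ls) b \<in> elems (tensor_word n (take (length ?ls) (word_labels n w)))"
            using b by (simp add: elems_tensor_word list_all2_takeI)
          moreover have "take (length ?ls) (word_labels n w) = ?ls"
            using word_labels_pair[OF i, of n] 0 by (simp add: word_labels_def)
          ultimately show ?thesis
            using length_concat_tensor_word[OF n ls, of c] length_concat_tensor_word[OF n ls top_in_tensor_word]
            by (simp add: c_def pw top_path_def)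
        qed
        ultimately have "linked n (top_path n ?ls) (take (length (concat c)) (concat (take (length ?ls + length ?ls') b)))"
          using linked_append top_path_mweights[OF n ls] top_path_mweights[OF n ls'] by force
        then show ?thesis by (simp add: take_add c_def pw)
      qed
      then show ?thesis
        using linked_highest_unique[OF n _ top_path_mweights[OF n ls] highest_top_path hc] by simp
    next
      case (Suc i)
      let ?ks = "letter_labels n (w ! i)"
      have i: "i < length w - 1" using Suc p by simp
      have wi: "word_labels n (take p w) = word_labels n (take i w) @ ?ks"
        using p Suc by (simp add: take_Suc_conv_app_nth word_labels_def)
      have ks: "set ?ks \<subseteq> {1..n}" "set (word_labels n (take i w)) \<subseteq> {1..n}" using ps by (auto simp: wi)
      let ?a = "take (?l i) b" and ?d = "take (length ?ks) (drop (?l i) b)"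
      have "concat ?a @ concat ?d = concat (take (?l p) b)"
        unfolding wi by (simp add: take_add)
      also have "\<dots> = top_path n (word_labels n (take i w)) @ top_path n ?ks"
        unfolding IH by (simp add: wi top_path_append)
      finally have ad: "concat ?a @ concat ?d = top_path n (word_labels n (take i w)) @ top_path n ?ks" .
      have "?a \<in> elems (tensor_word n (take (?l i) (word_labels n w)))"
        using b by (simp add: elems_tensor_word list_all2_takeI)
      moreover have "take (?l i) (word_labels n w) = word_labels n (take i w)"
        using word_labels_pair[OF i, of n] by simp
      ultimately have "length (concat ?a) = length (top_path n (word_labels n (take i w)))"
        using length_concat_tensor_word[OF n ks(2)] top_in_tensor_word
        by (metis top_path_def)
      \<comment> \<open>The parts before letter i have equal length, so they cancel and leave its
        factor as a top word.\<close>
      then have d: "concat ?d = top_path n ?ks" using ad by simp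
      have "linked n (top_path n ?ks @ top_path n ?ls) (concat (take (length ?ks + length ?ls) (drop (?l i) b)))"
        using ch[unfolded chained_def, rule_format, OF i] Suc
        by (simp add: word_labels_def top_path_append)
      also have "take (length ?ks + length ?ls) (drop (?l i) b) = ?d @ c"
        by (simp add: take_add c_def wi add.commute)
      finally have link: "linked n (top_path n ?ks @ top_path n ?ls) (top_path n ?ks @ concat c)"
        by (simp add: d)
      have "separated n (word_labels n (take i w) @ ?ks) ?ks ?ls"
        using sep[OF i] Suc wi by simp
      from separated_step[OF ks(2,1) ls this link] hc show ?thesis by (simp add: wi)
    qed
    then have "concat (take (?l (Suc p)) b) = top_path n (word_labels n (take p w)) @ top_path n ?ls"
      using cc by (simp only:)
    also have "\<dots> = top_path n (word_labels n (take (Suc p) w))" by (simp only: wp top_path_append)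
    finally show ?case .
  qed
  from this[of "length w"] show ?thesis using lb by simp
qed

theorem top_component_chained:
  assumes w: "set (word_labels n w) \<subseteq> {1..n}" and ne: "w \<notin> {[X], [Y], [Z]}"
    and sep: "\<And>i. i < length w - 1 \<Longrightarrow>
      separated n (word_labels n (take (Suc i) w)) (letter_labels n (w ! i)) (letter_labels n (w ! (i + 1)))"
  shows "top_component n (word_labels n w) =
    {b \<in> elems (tensor_word n (word_labels n w)). chained n w b}"
proof (intro set_eqI iffI)
  let ?W = "tensor_word n (word_labels n w)" and ?u = "map (top_elem n) (word_labels n w)"
  note W = pathlike_tensor_word[OF n w]
  have cu: "concat ?u = top_path n (word_labels n w)" by (simp add: top_path_def)
  fix b
  {
    assume "b \<in> top_component n (word_labels n w)"
    then show "b \<in> {b \<in> elems ?W. chained n w b}"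
      using chained_linked[OF w top_in_tensor_word _ _ chained_top, of b]
      unfolding top_component_iff[OF n w] cu by blast
  next
    assume "b \<in> {b \<in> elems ?W. chained n w b}"
    then have b: "b \<in> elems ?W" "chained n w b" by auto
    \<comment> \<open>Raising stays in the component and keeps the pair conditions, so it must end
      at the top word.\<close>
    obtain y where y: "(concat b, y) \<in> (raising n UNIV)\<^sup>*" "highest UNIV y"
      using raise_to_highest[OF n] pathlikeD(4)[OF W b(1)] by blast
    then obtain c where c: "c \<in> elems ?W" "concat c = y" using pathlike_raising[OF n W b(1)] by blast
    have link: "linked n (concat b) (concat c)" using raising_linked y(1) c(2) by blast
    then have "chained n w c" using chained_linked[OF w b(1) c(1) _ b(2)] by blast
    then have "concat c = top_path n (word_labels n w)"
      using chained_highest[OF w ne sep c(1)] y(2) c(2) by blast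
    then show "b \<in> top_component n (word_labels n w)"
      unfolding top_component_iff[OF n w] using b(1) link linked_sym by metis
  }
qed

section \<open>The product of the padded projectors\<close>

lemma sigma_proj_on:
  assumes "set (word_labels n w) \<subseteq> {1..n}" and i: "i < length w - 1"
  shows "\<exists>S. sigma n w i = proj_on S \<and> (\<forall>b\<in>elems (tensor_word n (word_labels n w)).
    b \<in> S \<longleftrightarrow> linked n (top_path n (word_labels n [w ! i, w ! (i + 1)]))
      (concat (take (length (word_labels n [w ! i, w ! (i + 1)]))
        (drop (length (word_labels n (take i w))) b))))"
proof -
  let ?l = "word_labels n (take i w)" and ?m = "word_labels n [w ! i, w ! (i + 1)]"
    and ?r = "word_labels n (drop (i + 2) w)"
  let ?S = "{b. take (length ?l) b \<in> elems (tensor_word n ?l) \<and>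
    drop (length ?l) b \<in> {b. take (length ?m) b \<in> top_component n ?m \<and>
      drop (length ?m) b \<in> elems (tensor_word n ?r)}}"
  have "sigma n w i = proj_on ?S"
    unfolding sigma_def padded_jones_wenzl_def jones_wenzl_def id_crystal_def tensor_map_proj_on ..
  \<comment> \<open>On elements of the tensor word the clauses for the padding factors hold, which
    leaves the condition on the middle pair.\<close>
  moreover have "b \<in> ?S \<longleftrightarrow> linked n (top_path n ?m) (concat (take (length ?m) (drop (length ?l) b)))"
    if "b \<in> elems (tensor_word n (word_labels n w))" for b
  proof -
    have "set ?m \<subseteq> {1..n}" using assms(1) unfolding word_labels_pair[OF i] by simp
    note top = top_component_iff[OF n this]
    have "b \<in> elems (tensor_word n (?l @ ?m @ ?r))" using that word_labels_pair[OF i, of n] by simp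
    then have b: "list_all2 (\<lambda>b k. b \<in> elems (fund_crystal n k)) b (?l @ ?m @ ?r)"
      by (simp add: elems_tensor_word)
    have "take (length ?l) b \<in> elems (tensor_word n ?l)"
      "take (length ?m) (drop (length ?l) b) \<in> elems (tensor_word n ?m)"
      "drop (length ?m) (drop (length ?l) b) \<in> elems (tensor_word n ?r)"
      using list_all2_takeI[OF b, of "length ?l"] list_all2_takeI[OF list_all2_dropI[OF b, of "length ?l"], of "length ?m"]
        list_all2_dropI[OF list_all2_dropI[OF b, of "length ?l"], of "length ?m"]
      by (simp_all add: elems_tensor_word)
    then show ?thesis by (simp only: mem_Collect_eq top simp_thms)
  qed
  ultimately show ?thesis by blast
qed

lemma sigma_prod_proj_on:
  assumes "set (word_labels n w) \<subseteq> {1..n}"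
  shows "sigma_prod n w = proj_on {b \<in> elems (tensor_word n (word_labels n w)). chained n w b}"
proof -
  let ?E = "elems (tensor_word n (word_labels n w))"
  obtain S where S: "\<And>i. i < length w - 1 \<Longrightarrow> sigma n w i = proj_on (S i)"
    "\<And>i b. i < length w - 1 \<Longrightarrow> b \<in> ?E \<Longrightarrow> b \<in> S i \<longleftrightarrow>
      linked n (top_path n (word_labels n [w ! i, w ! (i + 1)]))
      (concat (take (length (word_labels n [w ! i, w ! (i + 1)]))
        (drop (length (word_labels n (take i w))) b)))"
    using sigma_proj_on[OF assms] by metis
  have "map (sigma n w) [0..<length w - 1] = map (\<lambda>i. proj_on (S i)) [0..<length w - 1]"
    using S(1) by (intro map_cong) auto
  then have "sigma_prod n w = proj_on (?E \<inter> (\<Inter>i\<in>set [0..<length w - 1]. S i))"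
    unfolding sigma_prod_def id_crystal_def foldr_proj_on[symmetric] by (rule arg_cong)
  also have "?E \<inter> (\<Inter>i\<in>set [0..<length w - 1]. S i) = {b \<in> ?E. chained n w b}"
    using S(2) by (auto simp: chained_def)
  finally show ?thesis .
qed

end

section \<open>The arranged words\<close>

lemma separated_spin:
  assumes n: "n \<ge> 3" and r: "r \<le> Suc 0"
    and v: "v = replicate a X @ replicate q Y @ replicate r (Fund n) \<or>
      v = replicate a X @ replicate q Z @ replicate r (Fund (n - 1))"
    and i: "Suc i < length v"
  shows "set (letter_labels n (v ! Suc i)) \<subseteq> set (letter_labels n (v ! i))"
  using v
proof
  assume v: "v = replicate a X @ replicate q Y @ replicate r (Fund n)"
  have "Suc i < a + q + r" using i by (simp add: v)
  \<comment> \<open>As r \<le> 1, position i holds X or Y. The labels of X comprise both spin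
    labels; after a Y only the label n occurs.\<close>
  then consider "i < a" | "a \<le> i" "i < a + q" using r by linarith
  then show ?thesis
    by cases (use i r in \<open>auto simp: v nth_append nth_Cons' split: if_splits\<close>)
next
  assume v: "v = replicate a X @ replicate q Z @ replicate r (Fund (n - 1))"
  have "Suc i < a + q + r" using i by (simp add: v)
  then consider "i < a" | "a \<le> i" "i < a + q" using r by linarith
  then show ?thesis
    by cases (use i r in \<open>auto simp: v nth_append nth_Cons' split: if_splits\<close>)
qed

text \<open>For a letter \<open>Fund k\<close> of the sorted part, sortedness bounds the earlier
  labels by k and the later ones are at least k, which is the cut at node k. Spin letters fall under
  the inclusion of label sets.\<close>

lemma separated_arranged:
  assumes n: "n \<ge> 3" and \<epsilon>s: "sorted \<epsilon>s" "set \<epsilon>s \<subseteq> {1..n - 2}" and r: "r \<le> Suc 0"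
    and v: "v = replicate a X @ replicate q Y @ replicate r (Fund n) \<or>
      v = replicate a X @ replicate q Z @ replicate r (Fund (n - 1))"
    and w: "w = map Fund \<epsilon>s @ v" and i: "i < length w - 1"
  shows "separated n (word_labels n (take (Suc i) w)) (letter_labels n (w ! i)) (letter_labels n (w ! (i + 1)))"
proof (cases "i < length \<epsilon>s")
  case True
  let ?k = "\<epsilon>s ! i"
  have k: "?k \<le> n - 2" using \<epsilon>s(2) nth_mem[OF True] by (auto simp: subset_iff)
  have "word_labels n (take (Suc i) w) = take (Suc i) \<epsilon>s"
    using True by (simp add: w word_labels_def take_map comp_def)
  moreover have "set (take (Suc i) \<epsilon>s) \<subseteq> {..?k}"
    using True sorted_nth_mono[OF \<epsilon>s(1), of _ i] by (auto simp: in_set_conv_nth less_Suc_eq_le)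
  moreover have "set (letter_labels n (w ! (i + 1))) \<subseteq> {?k..}"
  proof (cases "i + 1 < length \<epsilon>s")
    case True
    then show ?thesis using \<epsilon>s(1) by (auto simp: w nth_append intro: sorted_nth_mono)
  next
    case False
    then have "0 < length v" "i + 1 = length \<epsilon>s" using i True by (auto simp: w)
    then have "w ! (i + 1) \<in> set v" by (simp add: w nth_append)
    then have "set (letter_labels n (w ! (i + 1))) \<subseteq> {n - 1, n}" using v by auto
    then show ?thesis using k by auto
  qed
  ultimately show ?thesis
    using True k by (auto simp: separated_def w nth_append)
next
  case False
  then obtain j where j: "i = length \<epsilon>s + j" by (metis le_add_diff_inverse not_less)
  then have "Suc j < length v" using i by (auto simp: w)
  from separated_spin[OF n r v this] show ?thesis
    by (simp add: separated_def w j nth_append)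
qed

theorem theorem3p1p7:
  fixes n a b q r s :: nat and \<epsilon> \<epsilon>s :: "nat list" and w :: "letter list"
  assumes n: "n \<ge> 3"
    and a: "a = count_list \<epsilon> (n - 1)"
    and b: "b = count_list \<epsilon> n"
    and \<epsilon>s: "length \<epsilon>s = s" "sorted \<epsilon>s" "set \<epsilon>s \<subseteq> {1..n - 2}"
    and r: "r \<in> {0, 1}"
    and arranged:
      "b \<ge> a \<and> b - a = 2 * q + r \<and>
         w = map Fund \<epsilon>s @ replicate a X @ replicate q Y @ replicate r (Fund n)
       \<or> a > b \<and> a - b = 2 * q + r \<and>
         w = map Fund \<epsilon>s @ replicate b X @ replicate q Z @ replicate r (Fund (n - 1))"
    and \<epsilon>: "\<epsilon> = word_labels n w"
    and not_single: "w \<notin> {[X], [Y], [Z]}"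
  shows "jones_wenzl n \<epsilon> = sigma_prod n w"
proof -
  \<comment> \<open>Both arrangements have one shape, with \<open>c\<close> as the common name for
    the exponent of X.\<close>
  obtain c v where w: "w = map Fund \<epsilon>s @ v"
    and v: "v = replicate c X @ replicate q Y @ replicate r (Fund n) \<or>
      v = replicate c X @ replicate q Z @ replicate r (Fund (n - 1))"
    using arranged by blast
  have "1 \<le> n - 1" using n by simp
  then have "set (letter_labels n l) \<subseteq> {1..n}" if "l \<in> set w" for l
    using that w v \<epsilon>s(3) n by (auto simp: subset_iff)
  then have labels: "set (word_labels n w) \<subseteq> {1..n}" by (auto simp: word_labels_def)
  have "r \<le> Suc 0" using r by auto
  then have "top_component n (word_labels n w) =
      {b \<in> elems (tensor_word n (word_labels n w)). chained n w b}"
    by (intro top_component_chained[OF n labels not_single] separated_arranged[OF n \<epsilon>s(2,3) _ v w])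
  then show ?thesis
    by (simp only: \<epsilon> jones_wenzl_def sigma_prod_proj_on[OF n labels])
qed

end
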